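(* Let $\sigma\in\mathscr B_{\mathfrak g}$. Then for each $\underline\mu=(\mu_i(u))_{i\in I}\in\mathscr M^I$, there exists a unique element $\sigma^{\mathscr M}(\underline\mu)\in\mathscr M^I$ satisfying $$\sigma\left(\frac{\mathsf q^{2D}\underline\mu}{\underline\mu}\right)=\frac{\mathsf q^{2D}\sigma^{\mathscr M}(\underline\mu)}{\sigma^{\mathscr M}(\underline\mu)}.$$ Moreover, the formula $\sigma\cdot\underline\mu=\sigma^{\mathscr M}(\underline\mu)$ determines an action of $\mathscr B_{\mathfrak g}$ on $\mathscr M^I$ by group automorphisms for which $\deg:\mathscr M^I\to\Lambda$ is a $\mathscr B_{\mathfrak g}$-equivariant map: $\deg\sigma^{\mathscr M}(\underline\mu)=\sigma\cdot\deg(\underline\mu)$.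
   Context: $\mathfrak g$ is a simple Lie algebra over $\mathbb C$ with Cartan matrix $(a_{ij})_{i,j\in I}$, minimal symmetrizing integers $d_i$ ($d_ia_{ij}=d_ja_{ji}$), fundamental weights $\varpi_i$, weight lattice $\Lambda=\bigoplus_i\mathbb Z\varpi_i$. $\mathscr B_{\mathfrak g}$ is the braid group with generators $\tau_i$ ($i\in I$) and relations $\tau_i\tau_j\tau_i\cdots=\tau_j\tau_i\tau_j\cdots$ ($m_{ij}$ factors on each side, $i\ne j$; $m_{ij}=2,3,4,6$ for $a_{ij}a_{ji}=0,1,2,3$). It acts on $\Lambda$ through the Weyl group ($\tau_i$ acts by $s_i$). Fix $\hbar\in\mathbb C^\times$. $\mathscr B_{\mathfrak g}$ acts on the group $(1+u^{-1}\mathbb C[[u^{-1}]])^I$ by group automorphisms, with generators acting by $$\tau_j(\underline\lambda)_i=\lambda_i(u)\prod_{k=0}^{|a_{ji}|-1}\lambda_j\big(u-\tfrac{\hbar d_j}2(|a_{ji}|-2k)\big)^{(-1)^{\delta_{ij}}}$$ ($i$-th component); this is the dual of the action of $\mathscr B_{\mathfrak g}$ on the commutative subalgebra $Y^0_\hbar(\mathfrak g)$ of the Yangian by modified braid group operators, under $\mathrm{Hom}_{Alg}(Y^0_\hbar(\mathfrak g),\mathbb C)\cong(1+u^{-1}\mathbb C[[u^{-1}]])^I$. This is the action denoted $\sigma(\cdot)$ in the claim. $\mathscr M=\bigcup_{k\in\mathbb Z}u^k(1+u^{-1}\mathbb C[[u^{-1}]])\subset\mathbb C((u^{-1}))^\times$,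 and $\mathscr M^I$ is a group under componentwise multiplication. $\mathsf q^{2D}\underline\mu=(\mu_i(u+\hbar d_i))_{i\in I}$. Note $(\mathsf q^{2D}\underline\mu)\underline\mu^{-1}\in(1+u^{-1}\mathbb C[[u^{-1}]])^I$. $\deg(\underline\mu)=\sum_{i\in I}\deg\mu_i(u)\,\varpi_i$, where $\deg\mu_i(u)$ is the unique integer $k$ with $u^{-k}\mu_i(u)\in1+u^{-1}\mathbb C[[u^{-1}]]$. *)

theory Defs
  imports
    "HOL-Algebra.Algebra"
    "HOL-Computational_Algebra.Computational_Algebra"
begin

section \<open>Cartan data\<close>

definition symmetrizer :: "('i \<Rightarrow> 'i \<Rightarrow> int) \<Rightarrow> ('i \<Rightarrow> nat) \<Rightarrow> bool" where
  "symmetrizer a d \<longleftrightarrow> (\<forall>i. d i > 0) \<and> (\<forall>i j. int (d i) * a i j = int (d j) * a j i)"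

definition minimal_symmetrizer :: "('i \<Rightarrow> 'i \<Rightarrow> int) \<Rightarrow> ('i \<Rightarrow> nat) \<Rightarrow> bool" where
  "minimal_symmetrizer a d \<longleftrightarrow>
     symmetrizer a d \<and> (\<forall>d'. symmetrizer a d' \<longrightarrow> (\<forall>i. d i \<le> d' i))"

text \<open>The Cartan matrices of the simple complex Lie algebras: the indecomposable Cartan matrices
  of finite type (by the Cartan-Killing classification and Serre's theorem). Convention:
  \<open>a i j\<close> is the value of the simple root \<open>\<alpha>\<^sub>j\<close> on the simple coroot of \<open>\<alpha>\<^sub>i\<close>.\<close>

definition simple_cartan_matrix :: "('i::finite \<Rightarrow> 'i \<Rightarrow> int) \<Rightarrow> bool" where
  "simple_cartan_matrix a \<longleftrightarrow>
     (\<forall>i. a i i = 2) \<and>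
     (\<forall>i j. i \<noteq> j \<longrightarrow> a i j \<le> 0) \<and>
     (\<forall>i j. a i j = 0 \<longleftrightarrow> a j i = 0) \<and>
     (\<forall>J. J \<noteq> {} \<and> J \<noteq> UNIV \<longrightarrow> (\<exists>i\<in>J. \<exists>j\<in>-J. a i j \<noteq> 0)) \<and>
     (\<exists>d. symmetrizer a d \<and>
        (\<forall>x::'i \<Rightarrow> real. x \<noteq> (\<lambda>_. 0) \<longrightarrow>
           (\<Sum>i\<in>UNIV. \<Sum>j\<in>UNIV. of_nat (d i) * of_int (a i j) * x i * x j) > 0))"

section \<open>The braid group\<close>

text \<open>A word is a list of letters; \<open>(i, True)\<close> stands for \<open>\<tau>\<^sub>i\<close> and \<open>(i, False)\<close> for its inverse.\<close>

type_synonym 'i word = "('i \<times> bool) list"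

text \<open>For a Cartan matrix of finite type only the products 0, 1, 2, 3 occur.\<close>

definition braid_order :: "('i \<Rightarrow> 'i \<Rightarrow> int) \<Rightarrow> 'i \<Rightarrow> 'i \<Rightarrow> nat" where
  "braid_order a i j =
     (let p = a i j * a j i in if p = 0 then 2 else if p = 1 then 3 else if p = 2 then 4 else 6)"

definition alternating_word :: "'i \<Rightarrow> 'i \<Rightarrow> nat \<Rightarrow> 'i word" where
  "alternating_word i j m = map (\<lambda>k. (if even k then i else j, True)) [0..<m]"

inductive braid_equiv :: "('i \<Rightarrow> 'i \<Rightarrow> int) \<Rightarrow> 'i word \<Rightarrow> 'i word \<Rightarrow> bool"
  for a :: "'i \<Rightarrow> 'i \<Rightarrow> int" where
  refl: "braid_equiv a w w"
| sym: "braid_equiv a v w \<Longrightarrow> braid_equiv a w v"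
| trans: "braid_equiv a u v \<Longrightarrow> braid_equiv a v w \<Longrightarrow> braid_equiv a u w"
| cancel: "braid_equiv a (v @ [(i, b), (i, \<not> b)] @ w) (v @ w)"
| braid: "i \<noteq> j \<Longrightarrow>
    braid_equiv a (v @ alternating_word i j (braid_order a i j) @ w)
                  (v @ alternating_word j i (braid_order a i j) @ w)"

definition braid_rel :: "('i \<Rightarrow> 'i \<Rightarrow> int) \<Rightarrow> ('i word \<times> 'i word) set" where
  "braid_rel a = {(v, w). braid_equiv a v w}"

definition braid_group :: "('i \<Rightarrow> 'i \<Rightarrow> int) \<Rightarrow> 'i word set monoid" where
  "braid_group a =
     \<lparr>carrier = UNIV // braid_rel a,
      monoid.mult = (\<lambda>A B. \<Union>v\<in>A. \<Union>w\<in>B. braid_rel a `` {v @ w}),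
      one = braid_rel a `` {[]}\<rparr>"

fun eval_word :: "('g, 'b) monoid_scheme \<Rightarrow> ('i \<Rightarrow> 'g) \<Rightarrow> 'i word \<Rightarrow> 'g" where
  "eval_word H f [] = \<one>\<^bsub>H\<^esub>"
| "eval_word H f ((i, b) # w) = (if b then f i else inv\<^bsub>H\<^esub> f i) \<otimes>\<^bsub>H\<^esub> eval_word H f w"

text \<open>The homomorphism from the braid group to \<open>H\<close> sending \<open>\<tau>\<^sub>i\<close> to \<open>f i\<close>, provided that the \<open>f i\<close>
  satisfy the braid relations, so that all words in a class have the same value in \<open>H\<close>.\<close>

definition braid_hom :: "('g, 'b) monoid_scheme \<Rightarrow> ('i \<Rightarrow> 'g) \<Rightarrow> 'i word set \<Rightarrow> 'g" where
  "braid_hom H f \<sigma> = the_elem (eval_word H f ` \<sigma>)"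

section \<open>The weight lattice\<close>

text \<open>The family \<open>k\<close> stands for the weight \<open>\<Sum>\<^sub>i k\<^sub>i \<varpi>\<^sub>i\<close>. In these coordinates \<open>\<alpha>\<^sub>j\<close> is the \<open>j\<close>-th
  column of \<open>a\<close>, and the value of \<open>k\<close> on the \<open>j\<close>-th simple coroot is \<open>k j\<close>.\<close>

definition weight_lattice :: "('i \<Rightarrow> int) monoid" where
  "weight_lattice = product_group UNIV (\<lambda>_. integer_group)"

definition simple_reflection :: "('i \<Rightarrow> 'i \<Rightarrow> int) \<Rightarrow> 'i \<Rightarrow> ('i \<Rightarrow> int) \<Rightarrow> 'i \<Rightarrow> int" where
  "simple_reflection a j k = (\<lambda>i. k i - k j * a i j)"

definition weight_action :: "('i \<Rightarrow> 'i \<Rightarrow> int) \<Rightarrow> 'i word set \<Rightarrow> ('i \<Rightarrow> int) \<Rightarrow> 'i \<Rightarrow> int" where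
  "weight_action a =
     braid_hom (AutoGroup weight_lattice)
       (\<lambda>j. restrict (simple_reflection a j) (carrier weight_lattice))"

section \<open>Series in the inverse of u\<close>

text \<open>The field of Laurent series in \<open>u\<inverse>\<close> is \<^typ>\<open>complex fls\<close>, whose variable \<^const>\<open>fls_X\<close> is
  \<open>u\<inverse>\<close>; hence \<open>u\<close> to the power \<open>k\<close> is \<open>fls_X_intpow (- k)\<close>.\<close>

definition unit_series :: "complex fls set" where
  "unit_series = {fps_to_fls g | g. fps_nth g 0 = 1}"

definition monic_series :: "complex fls set" where
  "monic_series = (\<Union>k::int. (\<lambda>g. fls_X_intpow (- k) * g) ` unit_series)"

definition unit_group :: "('i \<Rightarrow> complex fls) monoid" where
  "unit_group = product_group UNIV (\<lambda>_. \<lparr>carrier = unit_series, monoid.mult = (*), one = 1\<rparr>)"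

definition monic_group :: "('i \<Rightarrow> complex fls) monoid" where
  "monic_group = product_group UNIV (\<lambda>_. \<lparr>carrier = monic_series, monoid.mult = (*), one = 1\<rparr>)"

text \<open>\<open>f(u + c)\<close>: the substitution \<open>u \<mapsto> u + c\<close> sends \<open>X = u\<inverse>\<close> to \<open>(u + c)\<inverse> = X / (1 + c X)\<close>.\<close>

definition shift_arg :: "complex \<Rightarrow> complex fls \<Rightarrow> complex fls" where
  "shift_arg c f = fls_compose_fps f (fps_X / (1 + fps_const c * fps_X))"

definition q2D :: "('i \<Rightarrow> nat) \<Rightarrow> complex \<Rightarrow> ('i \<Rightarrow> complex fls) \<Rightarrow> 'i \<Rightarrow> complex fls" where
  "q2D d hbar \<mu> = (\<lambda>i. shift_arg (hbar * of_nat (d i)) (\<mu> i))"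

definition q2D_quotient :: "('i \<Rightarrow> nat) \<Rightarrow> complex \<Rightarrow> ('i \<Rightarrow> complex fls) \<Rightarrow> 'i \<Rightarrow> complex fls" where
  "q2D_quotient d hbar \<mu> = (\<lambda>i. q2D d hbar \<mu> i / \<mu> i)"

definition deg_series :: "complex fls \<Rightarrow> int" where
  "deg_series f = (THE k. fls_X_intpow k * f \<in> unit_series)"

definition deg_tuple :: "('i \<Rightarrow> complex fls) \<Rightarrow> 'i \<Rightarrow> int" where
  "deg_tuple \<mu> = (\<lambda>i. deg_series (\<mu> i))"

section \<open>The braid group actions on tuples of series\<close>

definition unit_generator ::
  "('i \<Rightarrow> 'i \<Rightarrow> int) \<Rightarrow> ('i \<Rightarrow> nat) \<Rightarrow> complex \<Rightarrow> 'i \<Rightarrow> ('i \<Rightarrow> complex fls) \<Rightarrow> 'i \<Rightarrow> complex fls" where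
  "unit_generator a d hbar j \<xi> = (\<lambda>i. \<xi> i *
     (\<Prod>k<nat \<bar>a j i\<bar>.
        shift_arg (- (hbar * of_nat (d j) / 2 * of_int (\<bar>a j i\<bar> - 2 * int k))) (\<xi> j)
          powi ((-1) ^ of_bool (i = j))))"

definition unit_action ::
  "('i \<Rightarrow> 'i \<Rightarrow> int) \<Rightarrow> ('i \<Rightarrow> nat) \<Rightarrow> complex \<Rightarrow>
   'i word set \<Rightarrow> ('i \<Rightarrow> complex fls) \<Rightarrow> 'i \<Rightarrow> complex fls" where
  "unit_action a d hbar =
     braid_hom (AutoGroup unit_group)
       (\<lambda>j. restrict (unit_generator a d hbar j) (carrier unit_group))"

definition monic_action ::
  "('i \<Rightarrow> 'i \<Rightarrow> int) \<Rightarrow> ('i \<Rightarrow> nat) \<Rightarrow> complex \<Rightarrow>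
   'i word set \<Rightarrow> ('i \<Rightarrow> complex fls) \<Rightarrow> 'i \<Rightarrow> complex fls" where
  "monic_action a d hbar \<sigma> \<mu> =
     (THE \<nu>. \<nu> \<in> carrier monic_group \<and>
             unit_action a d hbar \<sigma> (q2D_quotient d hbar \<mu>) = q2D_quotient d hbar \<nu>)"

end

theory Submission
  imports Defs
begin

text \<open>
  Everything follows from one change of coordinates. For a monic series \<open>f\<close>, the logarithmic
  derivative \<open>f' / f\<close> with respect to \<open>u\<close> lies in \<open>u\<inverse> \<complex>[[u\<inverse>]]\<close>. Its formal Borel transform, which
  sends \<open>u ^ (- n - 1)\<close> to \<open>z ^ n / n!\<close>, is a power series \<open>L(f)\<close> in \<open>z\<close>
  (\<open>borel_log\<close>). The map \<open>L\<close> turns products into sums, it is injective on monic series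
  (\<open>inj_on_borel_log\<close>), the constant term of \<open>L(f)\<close> is the degree of \<open>f\<close> (\<open>borel_log_nth_0\<close>), and the
  substitution of \<open>u + c\<close> for \<open>u\<close> becomes multiplication by \<open>exp(- c z)\<close> (\<open>borel_log_shift_arg\<close>).

  In these coordinates the generator \<open>\<tau>\<^sub>j\<close> of the action on tuples of unit series is a
  pseudo-reflection \<open>x\<^sub>i \<mapsto> x\<^sub>i - P\<^sub>j\<^sub>i x\<^sub>j\<close> with coefficients in the commutative ring \<open>\<complex>[[z]]\<close>, where
  \<open>P\<close> is a Cartan matrix whose entries are sums of exponentials. This is a reflection representation
  of a Hecke algebra with unequal parameters. The braid relations are polynomial identities, one for
  each of the four possible values of \<open>a\<^sub>i\<^sub>j a\<^sub>j\<^sub>i\<close>, which hold because the product \<open>P\<^sub>i\<^sub>j P\<^sub>j\<^sub>i\<close> has the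
  right expression in terms of the diagonal entries (\<open>yangian_cartan_braid\<close>). Injectivity of \<open>L\<close>
  carries them back to unit series.

  The map \<open>\<mu> \<mapsto> q\<^sup>2\<^sup>D \<mu> / \<mu>\<close> multiplies the \<open>i\<close>-th coordinate by \<open>exp(- \<hbar> d\<^sub>i z) - 1\<close>, which is not a
  zero divisor; so it is injective on monic tuples, and this is the uniqueness claim. For existence
  there is an explicit lift of \<open>\<tau>\<^sub>j\<close> to monic tuples: it is given by the formula that defines \<open>\<tau>\<^sub>j\<close>,
  with \<open>d\<^sub>j, a\<^sub>j\<^sub>i\<close> replaced by \<open>d\<^sub>i, a\<^sub>i\<^sub>j\<close>. The sum of exponentials in \<open>P\<^sub>j\<^sub>i\<close> is geometric, so after
  multiplication by \<open>exp(- \<hbar> d\<^sub>j z) - 1\<close> it depends only on \<open>d\<^sub>j a\<^sub>j\<^sub>i = d\<^sub>i a\<^sub>i\<^sub>j\<close>; this is why the lift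
  intertwines (\<open>q2D_quotient_monic_generator\<close>).

  The remaining assertions are transported along equivariant maps. The braid relations for the lifts
  follow from those on unit series, because the map \<open>\<mu> \<mapsto> q\<^sup>2\<^sup>D \<mu> / \<mu>\<close> is injective; evaluating at
  \<open>z = 0\<close> turns the lifts into simple reflections of the degrees, and the braid relations on the weight
  lattice follow because the degree map is surjective.
\<close>


section \<open>Evaluation of braid words\<close>

lemma braid_equiv_append:
  assumes "braid_equiv a v v'"
  shows "braid_equiv a (x @ v @ y) (x @ v' @ y)"
  using assms
proof (induction rule: braid_equiv.induct)
  case (cancel v i b w)
  then show ?case using braid_equiv.cancel[of a "x @ v" i b "w @ y"] by simp
next
  case (braid i j v w)
  then show ?case using braid_equiv.braid[of i j a "x @ v" "w @ y"] by simp
qed (blast intro: braid_equiv.refl braid_equiv.sym braid_equiv.trans)+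

lemma braid_equiv_append_cong:
  assumes "braid_equiv a v v'" and "braid_equiv a w w'"
  shows "braid_equiv a (v @ w) (v' @ w')"
  using braid_equiv.trans[OF braid_equiv_append[OF assms(1), of "[]" w]]
    braid_equiv_append[OF assms(2), of v' "[]"] by simp

lemma equiv_braid_rel: "equiv UNIV (braid_rel a)"
  unfolding braid_rel_def by (rule equivI)
    (simp_all add: refl_on_def sym_def trans_def,
     (blast intro: braid_equiv.refl braid_equiv.sym braid_equiv.trans)+)

abbreviation braid_class :: "('i \<Rightarrow> 'i \<Rightarrow> int) \<Rightarrow> 'i word \<Rightarrow> 'i word set" where
  "braid_class a w \<equiv> braid_rel a `` {w}"

lemma carrier_braid_group: "carrier (braid_group a) = range (braid_class a)"
  by (auto simp: braid_group_def quotient_def)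

lemma one_braid_group: "\<one>\<^bsub>braid_group a\<^esub> = braid_class a []"
  by (simp add: braid_group_def)

text \<open>Concatenation respects braid equivalence, so the union over all representatives that
  defines the product in the braid group is a single class.\<close>

lemma mult_braid_group:
  "braid_class a v \<otimes>\<^bsub>braid_group a\<^esub> braid_class a w = braid_class a (v @ w)"
proof -
  have "braid_class a (v @ w) = braid_class a (v' @ w')"
    if "(v, v') \<in> braid_rel a" "(w, w') \<in> braid_rel a" for v v' w w'
    using that braid_equiv_append_cong[of a v v' w w']
    by (intro equiv_class_eq[OF equiv_braid_rel]) (simp add: braid_rel_def)
  then have "congruent2 (braid_rel a) (braid_rel a) (\<lambda>v w. braid_class a (v @ w))"
    unfolding congruent2_def by blast
  from UN_equiv_class2[OF equiv_braid_rel equiv_braid_rel this]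
  show ?thesis by (simp add: braid_group_def)
qed

lemma braid_equiv_inverse_word:
  "braid_equiv a (rev (map (\<lambda>(i, b). (i, \<not> b)) w) @ w) []"
proof (induction w)
  case Nil
  show ?case by (simp add: braid_equiv.refl)
next
  case (Cons l w)
  obtain i b where "l = (i, b)" by force
  then show ?case
    using braid_equiv.cancel[of a "rev (map (\<lambda>(i, b). (i, \<not> b)) w)" i "\<not> b" w]
      braid_equiv.trans[OF _ Cons.IH] by simp
qed

lemma group_braid_group: "group (braid_group a)"
proof (rule groupI)
  fix x assume "x \<in> carrier (braid_group a)"
  then obtain w where w: "x = braid_class a w" by (auto simp: carrier_braid_group)
  have "braid_class a (rev (map (\<lambda>(i, b). (i, \<not> b)) w)) \<otimes>\<^bsub>braid_group a\<^esub> x = \<one>\<^bsub>braid_group a\<^esub>"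
    unfolding w mult_braid_group one_braid_group
    using braid_equiv_inverse_word[of a w]
    by (intro equiv_class_eq[OF equiv_braid_rel]) (simp add: braid_rel_def)
  then show "\<exists>y\<in>carrier (braid_group a). y \<otimes>\<^bsub>braid_group a\<^esub> x = \<one>\<^bsub>braid_group a\<^esub>"
    by (auto simp: carrier_braid_group)
qed (auto simp: carrier_braid_group one_braid_group mult_braid_group)

definition braid_relations ::
  "('i \<Rightarrow> 'i \<Rightarrow> int) \<Rightarrow> ('g, 'b) monoid_scheme \<Rightarrow> ('i \<Rightarrow> 'g) \<Rightarrow> bool" where
  "braid_relations a H f \<longleftrightarrow> (\<forall>i j. i \<noteq> j \<longrightarrow>
     eval_word H f (alternating_word i j (braid_order a i j)) =
     eval_word H f (alternating_word j i (braid_order a i j)))"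

lemma eval_word_closed:
  assumes "group H" and "\<forall>j. f j \<in> carrier H"
  shows "eval_word H f w \<in> carrier H"
proof -
  interpret group H by fact
  show ?thesis
  proof (induction w)
    case (Cons l w)
    then show ?case by (cases l) (simp add: assms(2))
  qed simp
qed

lemma eval_word_append:
  assumes "group H" and "\<forall>j. f j \<in> carrier H"
  shows "eval_word H f (v @ w) = eval_word H f v \<otimes>\<^bsub>H\<^esub> eval_word H f w"
proof -
  interpret group H by fact
  show ?thesis
  proof (induction v)
    case (Cons l v)
    then show ?case by (cases l) (simp add: assms(2) m_assoc eval_word_closed[OF assms])
  qed (simp add: eval_word_closed[OF assms])
qed

lemma eval_word_braid_equiv:
  assumes H: "group H" "\<forall>j. f j \<in> carrier H" and "braid_relations a H f"
    and "braid_equiv a v w"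
  shows "eval_word H f v = eval_word H f w"
  using assms(4)
proof (induction rule: braid_equiv.induct)
  case (cancel v i b w)
  interpret group H by fact
  have "f i \<otimes>\<^bsub>H\<^esub> (inv\<^bsub>H\<^esub> f i \<otimes>\<^bsub>H\<^esub> eval_word H f w) = eval_word H f w"
    and "inv\<^bsub>H\<^esub> f i \<otimes>\<^bsub>H\<^esub> (f i \<otimes>\<^bsub>H\<^esub> eval_word H f w) = eval_word H f w"
    by (simp_all add: H(2) eval_word_closed[OF H] flip: m_assoc)
  then show ?case by (cases b) (simp_all add: eval_word_append[OF H])
next
  case (braid i j v w)
  then have "eval_word H f (alternating_word i j (braid_order a i j)) =
      eval_word H f (alternating_word j i (braid_order a i j))"
    using assms(3) unfolding braid_relations_def by blast
  then show ?case by (simp add: eval_word_append[OF H])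
qed auto

lemma braid_hom_class:
  assumes "group H" and "\<forall>j. f j \<in> carrier H" and "braid_relations a H f"
  shows "braid_hom H f (braid_class a w) = eval_word H f w"
proof -
  have "eval_word H f ` braid_class a w = {eval_word H f w}"
  proof -
    have "eval_word H f v = eval_word H f w" if "v \<in> braid_class a w" for v
      using eval_word_braid_equiv[OF assms, of w v] that by (simp add: braid_rel_def)
    moreover have "w \<in> braid_class a w" by (simp add: braid_rel_def braid_equiv.refl)
    ultimately show ?thesis by blast
  qed
  then show ?thesis by (simp add: braid_hom_def)
qed

lemma group_hom_braid_hom:
  assumes "group H" and "\<forall>j. f j \<in> carrier H" and "braid_relations a H f"
  shows "group_hom (braid_group a) H (braid_hom H f)"
proof -
  have "braid_hom H f \<in> hom (braid_group a) H"
    by (rule homI)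
       (auto simp: carrier_braid_group mult_braid_group braid_hom_class[OF assms]
         eval_word_append[OF assms(1,2)] intro: eval_word_closed[OF assms(1,2)])
  then show ?thesis
    using assms(1) group_braid_group by (simp add: group_hom_def group_hom_axioms_def)
qed

section \<open>Automorphism groups\<close>

lemma carrier_AutoGroup: "carrier (AutoGroup G) = auto G"
  by (simp add: AutoGroup_def)

lemma auto_closed: "f \<in> auto G \<Longrightarrow> x \<in> carrier G \<Longrightarrow> f x \<in> carrier G"
  by (auto simp: auto_def dest: Bij_imp_funcset)

lemma auto_extensional: "f \<in> auto G \<Longrightarrow> f \<in> extensional (carrier G)"
  by (auto simp: auto_def Bij_imp_extensional)

lemma mult_AutoGroup:
  assumes "f \<in> auto G" "g \<in> auto G" "x \<in> carrier G"
  shows "(f \<otimes>\<^bsub>AutoGroup G\<^esub> g) x = f (g x)"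
  using assms by (simp add: AutoGroup_def BijGroup_def auto_def compose_def)

lemma one_AutoGroup: "x \<in> carrier G \<Longrightarrow> \<one>\<^bsub>AutoGroup G\<^esub> x = x"
  by (simp add: AutoGroup_def BijGroup_def)

lemma AutoGroup_apply_inv:
  assumes "group G" "f \<in> auto G" "x \<in> carrier G"
  shows "f ((inv\<^bsub>AutoGroup G\<^esub> f) x) = x" and "(inv\<^bsub>AutoGroup G\<^esub> f) (f x) = x"
proof -
  interpret A: group "AutoGroup G" by (rule group.AutoGroup) fact
  have f: "f \<in> carrier (AutoGroup G)" using assms(2) by (simp add: carrier_AutoGroup)
  then have i: "inv\<^bsub>AutoGroup G\<^esub> f \<in> auto G" using carrier_AutoGroup A.inv_closed by blast
  show "f ((inv\<^bsub>AutoGroup G\<^esub> f) x) = x"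
    using mult_AutoGroup[OF assms(2) i assms(3)] A.r_inv[OF f] one_AutoGroup[OF assms(3)] by simp
  show "(inv\<^bsub>AutoGroup G\<^esub> f) (f x) = x"
    using mult_AutoGroup[OF i assms(2,3)] A.l_inv[OF f] one_AutoGroup[OF assms(3)] by simp
qed

lemma eval_word_auto:
  assumes "group G" and "\<forall>j. f j \<in> auto G"
  shows "eval_word (AutoGroup G) f w \<in> auto G"
  using eval_word_closed[of "AutoGroup G" f w] assms group.AutoGroup
  by (auto simp: carrier_AutoGroup)

text \<open>A map that intertwines the generators intertwines all words. Inverse letters cost nothing: since
  \<open>g i\<close> is injective, \<open>\<phi> (f i x) = g i (\<phi> x)\<close> can be read backwards.\<close>

lemma eval_word_intertwined:
  assumes G: "group G" "\<forall>j. f j \<in> auto G" and K: "group K" "\<forall>j. g j \<in> auto K"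
    and \<phi>: "\<And>x. x \<in> carrier G \<Longrightarrow> \<phi> x \<in> carrier K"
    and fg: "\<And>j x. x \<in> carrier G \<Longrightarrow> \<phi> (f j x) = g j (\<phi> x)"
    and "x \<in> carrier G"
  shows "\<phi> (eval_word (AutoGroup G) f w x) = eval_word (AutoGroup K) g w (\<phi> x)"
proof (induction w)
  case Nil
  then show ?case using assms by (simp add: one_AutoGroup)
next
  case (Cons l w)
  obtain i b where l: "l = (i, b)" by force
  let ?y = "eval_word (AutoGroup G) f w x"
  have y: "?y \<in> carrier G" using eval_word_auto[OF G] assms(7) by (rule auto_closed)
  interpret A: group "AutoGroup G" by (rule group.AutoGroup) fact
  interpret B: group "AutoGroup K" by (rule group.AutoGroup) fact
  have fi: "inv\<^bsub>AutoGroup G\<^esub> f i \<in> auto G" and gi: "inv\<^bsub>AutoGroup K\<^esub> g i \<in> auto K"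
    using G(2) K(2) A.inv_closed B.inv_closed by (auto simp: carrier_AutoGroup)
  have "\<phi> ((inv\<^bsub>AutoGroup G\<^esub> f i) ?y) = (inv\<^bsub>AutoGroup K\<^esub> g i) (\<phi> ?y)"
    using fg[OF auto_closed[OF fi y], of i] AutoGroup_apply_inv(1)[OF G(1) spec[OF G(2)] y, of i]
      AutoGroup_apply_inv(2)[OF K(1) spec[OF K(2)] \<phi>[OF auto_closed[OF fi y]], of i] by simp
  then show ?case
    using Cons.IH fg[OF y] y \<phi>[OF assms(7)] assms(7)
    by (simp add: l mult_AutoGroup eval_word_auto[OF G] eval_word_auto[OF K] G K fi gi)
qed

lemma braid_relations_AutoGroup_iff:
  fixes a :: "'i \<Rightarrow> 'i \<Rightarrow> int"
  assumes "group G" and "\<forall>j. f j \<in> auto G"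
  shows "braid_relations a (AutoGroup G) f \<longleftrightarrow> (\<forall>i j x. i \<noteq> j \<longrightarrow> x \<in> carrier G \<longrightarrow>
     eval_word (AutoGroup G) f (alternating_word i j (braid_order a i j)) x =
     eval_word (AutoGroup G) f (alternating_word j i (braid_order a i j)) x)"
proof -
  have "eval_word (AutoGroup G) f v = eval_word (AutoGroup G) f w \<longleftrightarrow>
      (\<forall>x\<in>carrier G. eval_word (AutoGroup G) f v x = eval_word (AutoGroup G) f w x)" for v w
    using extensionalityI[OF auto_extensional[OF eval_word_auto[OF assms]]
        auto_extensional[OF eval_word_auto[OF assms]], of v w] by auto
  then show ?thesis unfolding braid_relations_def by blast
qed

text \<open>Braid relations are inherited by an invariant subset, here in the form of an injective
  equivariant map into a set where they hold.\<close>

lemma braid_relations_inj: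
  fixes a :: "'i \<Rightarrow> 'i \<Rightarrow> int"
  assumes G: "group G" "\<forall>j. f j \<in> auto G" and K: "group K" "\<forall>j. g j \<in> auto K"
    and \<phi>: "\<And>x. x \<in> carrier G \<Longrightarrow> \<phi> x \<in> carrier K" "inj_on \<phi> (carrier G)"
    and fg: "\<And>j x. x \<in> carrier G \<Longrightarrow> \<phi> (f j x) = g j (\<phi> x)"
    and "braid_relations a (AutoGroup K) g"
  shows "braid_relations a (AutoGroup G) f"
  unfolding braid_relations_AutoGroup_iff[OF G]
proof (intro allI impI)
  fix i j :: 'i and x assume "i \<noteq> j" and x: "x \<in> carrier G"
  then have "eval_word (AutoGroup K) g (alternating_word i j (braid_order a i j)) (\<phi> x) =
      eval_word (AutoGroup K) g (alternating_word j i (braid_order a i j)) (\<phi> x)"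
    using assms(8) unfolding braid_relations_def by metis
  then show "eval_word (AutoGroup G) f (alternating_word i j (braid_order a i j)) x =
      eval_word (AutoGroup G) f (alternating_word j i (braid_order a i j)) x"
    using eval_word_intertwined[where \<phi> = \<phi> and f = f and g = g, OF G K \<phi>(1) fg x]
    by (intro inj_onD[OF \<phi>(2)] auto_closed[OF eval_word_auto[OF G] x]) simp
qed

text \<open>Dually, braid relations pass to quotients, here in the form of a surjective equivariant map.\<close>

lemma braid_relations_surj:
  fixes a :: "'i \<Rightarrow> 'i \<Rightarrow> int"
  assumes G: "group G" "\<forall>j. f j \<in> auto G" and K: "group K" "\<forall>j. g j \<in> auto K"
    and \<phi>: "\<phi> ` carrier G = carrier K"
    and fg: "\<And>j x. x \<in> carrier G \<Longrightarrow> \<phi> (f j x) = g j (\<phi> x)"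
    and "braid_relations a (AutoGroup G) f"
  shows "braid_relations a (AutoGroup K) g"
  unfolding braid_relations_AutoGroup_iff[OF K]
proof (intro allI impI)
  fix i j :: 'i and y assume ij: "i \<noteq> j" and y: "y \<in> carrier K"
  then obtain x where x: "x \<in> carrier G" "y = \<phi> x" using \<phi> by blast
  have *: "eval_word (AutoGroup K) g w y = \<phi> (eval_word (AutoGroup G) f w x)" for w
    using eval_word_intertwined[where \<phi> = \<phi> and f = f and g = g, OF G K _ fg x(1), of w]
      imageI[of _ "carrier G" \<phi>] unfolding \<phi> x(2) by simp
  show "eval_word (AutoGroup K) g (alternating_word i j (braid_order a i j)) y =
      eval_word (AutoGroup K) g (alternating_word j i (braid_order a i j)) y"
    using assms(7) ij unfolding braid_relations_def * by metis
qed

text \<open>All generators that occur have this shape: an automorphism of the \<open>j\<close>-th factor, and a multiplication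
  of the other factors by homomorphic images of the \<open>j\<close>-th component. The inverse first recovers the
  \<open>j\<close>-th component and then divides the others by the images.\<close>

lemma transvection_auto:
  fixes G :: "'g monoid"
  assumes "comm_group G" and g: "g \<in> hom G G" "bij_betw g (carrier G) (carrier G)"
    and h: "\<And>i. h i \<in> hom G G"
  defines "P \<equiv> product_group UNIV (\<lambda>_. G)"
  shows "(\<lambda>x\<in>carrier P. \<lambda>i. if i = j then g (x j) else x i \<otimes>\<^bsub>G\<^esub> h i (x j)) \<in> auto P"
    (is "?f \<in> _")
proof -
  interpret comm_group G by fact
  have gc: "g x \<in> carrier G" if "x \<in> carrier G" for x using g(1) that by (rule hom_in_carrier)
  have hc: "h i x \<in> carrier G" if "x \<in> carrier G" for i x using h that by (rule hom_in_carrier)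
  define g' where "g' = inv_into (carrier G) g"
  have g': "g' x \<in> carrier G" "g (g' x) = x" if "x \<in> carrier G" for x
    using g(2) that unfolding g'_def bij_betw_def by (metis inv_into_into, metis f_inv_into_f)
  have g'g: "g' (g x) = x" if "x \<in> carrier G" for x
    using g(2) that unfolding g'_def bij_betw_def by simp
  define f' where "f' x i = (if i = j then g' (x j) else x i \<otimes>\<^bsub>G\<^esub> inv\<^bsub>G\<^esub> h i (g' (x j)))" for x i
  have P: "x \<in> carrier P \<longleftrightarrow> (\<forall>i. x i \<in> carrier G)" for x
    by (auto simp: P_def PiE_UNIV_domain)
  have "bij_betw ?f (carrier P) (carrier P)"
  proof (rule bij_betw_byWitness[where f' = f'])
    show "\<forall>x\<in>carrier P. f' (?f x) = x"
      by (simp add: P f'_def g'g gc hc m_assoc fun_eq_iff)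
    show "\<forall>x\<in>carrier P. ?f (f' x) = x"
      by (simp add: P f'_def g' hc m_assoc fun_eq_iff)
    show "?f ` carrier P \<subseteq> carrier P"
      by (simp add: P image_subset_iff gc hc)
    show "f' ` carrier P \<subseteq> carrier P"
      by (simp add: P image_subset_iff f'_def g' hc)
  qed
  moreover have "?f \<in> hom P P"
  proof (rule homI)
    fix x y assume "x \<in> carrier P" "y \<in> carrier P"
    moreover have "x \<otimes>\<^bsub>P\<^esub> y = (\<lambda>i. x i \<otimes>\<^bsub>G\<^esub> y i)" for x y by (simp add: P_def fun_eq_iff)
    ultimately show "?f (x \<otimes>\<^bsub>P\<^esub> y) = ?f x \<otimes>\<^bsub>P\<^esub> ?f y"
      by (simp add: P hc hom_mult[OF g(1)] hom_mult[OF h] m_ac fun_eq_iff)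
  qed (simp add: P gc hc)
  ultimately show ?thesis by (simp add: auto_def Bij_def)
qed


section \<open>Monic series\<close>

text \<open>In terms of the variable \<open>X = u\<inverse>\<close>, the monic series are the Laurent series with leading coefficient
  1, and the unit series are those of subdegree 0. Closure properties then reduce to the
  multiplicativity of subdegree and leading coefficient. The degree in \<open>u\<close> is minus the subdegree.\<close>

lemma unit_series_iff: "f \<in> unit_series \<longleftrightarrow> f \<noteq> 0 \<and> fls_subdegree f = 0 \<and> fls_nth f 0 = 1"
proof
  assume "f \<in> unit_series"
  then obtain g where g: "f = fps_to_fls g" "fps_nth g 0 = 1" by (auto simp: unit_series_def)
  have "g \<noteq> 0" using g(2) by auto
  moreover have "subdegree g = 0" using g(2) by (simp add: subdegree_eq_0_iff)
  ultimately show "f \<noteq> 0 \<and> fls_subdegree f = 0 \<and> fls_nth f 0 = 1"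
    using g by (simp add: fls_subdegree_fls_to_fps)
next
  assume f: "f \<noteq> 0 \<and> fls_subdegree f = 0 \<and> fls_nth f 0 = 1"
  then have "f = fps_to_fls (fls_regpart f)" by simp
  with f show "f \<in> unit_series" unfolding unit_series_def
    by (metis (mono_tags, lifting) fls_regpart_nth int_ops(1) mem_Collect_eq)
qed

lemma monic_series_iff: "f \<in> monic_series \<longleftrightarrow> f \<noteq> 0 \<and> fls_nth f (fls_subdegree f) = 1"
proof
  assume "f \<in> monic_series"
  then obtain k g where g: "f = fls_X_intpow (- k) * g" "g \<in> unit_series"
    by (auto simp: monic_series_def)
  then show "f \<noteq> 0 \<and> fls_nth f (fls_subdegree f) = 1"
    by (simp only: fls_X_intpow_times_conv_shift) (simp add: unit_series_iff fls_shift_eq0_iff)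
next
  assume f: "f \<noteq> 0 \<and> fls_nth f (fls_subdegree f) = 1"
  have "f = fls_X_intpow (- (- fls_subdegree f)) * fls_shift (fls_subdegree f) f"
    by (simp add: fls_X_intpow_times_conv_shift)
  moreover have "fls_shift (fls_subdegree f) f \<in> unit_series"
    using f by (simp add: unit_series_iff fls_shift_eq0_iff)
  ultimately show "f \<in> monic_series" unfolding monic_series_def by blast
qed

lemma unit_series_iff_monic: "f \<in> unit_series \<longleftrightarrow> f \<in> monic_series \<and> fls_subdegree f = 0"
  by (auto simp: unit_series_iff monic_series_iff)

lemma monic_nonzero: "f \<in> monic_series \<Longrightarrow> f \<noteq> 0"
  by (simp add: monic_series_iff)

lemma monic_cases:
  assumes "f \<in> monic_series"
  obtains k g where "f = fls_X powi k * fps_to_fls g" "fps_nth g 0 = 1"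
proof -
  obtain k g where "f = fls_X_intpow (- k) * fps_to_fls g" "fps_nth g 0 = 1"
    using assms by (auto simp: monic_series_def unit_series_def)
  then show ?thesis using that[of "- k" g] by simp
qed

lemma monic_1: "1 \<in> monic_series" by (simp add: monic_series_iff)

lemma monic_X: "fls_X \<in> monic_series" by (simp add: monic_series_iff)

lemma monic_mult: "f \<in> monic_series \<Longrightarrow> g \<in> monic_series \<Longrightarrow> f * g \<in> monic_series"
  by (simp add: monic_series_iff)

lemma monic_inverse:
  assumes "f \<in> monic_series" shows "inverse f \<in> monic_series"
proof -
  have "f \<noteq> 0" using assms by (rule monic_nonzero)
  have "fls_nth (f * inverse f) (fls_subdegree f + fls_subdegree (inverse f)) =
      fls_nth f (fls_subdegree f) * fls_nth (inverse f) (fls_subdegree (inverse f))"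
    by (rule fls_times_base)
  then show ?thesis using assms by (simp add: monic_series_iff fls_inverse_subdegree)
qed

lemma monic_power: "f \<in> monic_series \<Longrightarrow> f ^ n \<in> monic_series"
  by (induction n) (auto intro: monic_mult monic_1)

lemma monic_powi: "f \<in> monic_series \<Longrightarrow> f powi k \<in> monic_series"
  by (simp add: power_int_def monic_power monic_inverse)

lemma monic_prod: "(\<And>k. k \<in> A \<Longrightarrow> F k \<in> monic_series) \<Longrightarrow> prod F A \<in> monic_series"
  by (induction A rule: infinite_finite_induct) (auto intro: monic_mult monic_1)

lemma unit_mult: "f \<in> unit_series \<Longrightarrow> g \<in> unit_series \<Longrightarrow> f * g \<in> unit_series"
  by (simp add: unit_series_iff_monic monic_mult monic_nonzero)

lemma unit_inverse: "f \<in> unit_series \<Longrightarrow> inverse f \<in> unit_series"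
  by (simp add: unit_series_iff_monic monic_inverse monic_nonzero fls_inverse_subdegree)

lemma unit_power: "f \<in> unit_series \<Longrightarrow> f ^ n \<in> unit_series"
  by (induction n) (simp_all add: unit_mult unit_series_iff_monic[of 1] monic_1)

lemma unit_powi: "f \<in> unit_series \<Longrightarrow> f powi k \<in> unit_series"
  by (simp add: power_int_def unit_power unit_inverse)

lemma deg_series_monic:
  assumes "f \<in> monic_series" shows "deg_series f = - fls_subdegree f"
  unfolding deg_series_def
proof (rule the_equality)
  have X: "fls_X_intpow k * f \<in> monic_series" for k
    using monic_mult[OF monic_powi[OF monic_X] assms, of k] by simp
  have sub: "fls_subdegree (fls_X_intpow k * f) = fls_subdegree f + k" for k
    using monic_nonzero[OF assms] by (rule fls_subdegree_mult_fls_X_intpow)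
  show "fls_X_intpow (- fls_subdegree f) * f \<in> unit_series"
    using X[of "- fls_subdegree f"] sub[of "- fls_subdegree f"] by (simp add: unit_series_iff_monic)
  fix k assume "fls_X_intpow k * f \<in> unit_series"
  then show "k = - fls_subdegree f" using sub[of k] by (simp add: unit_series_iff_monic)
qed

section \<open>Shifts of the argument\<close>

definition shift_var :: "complex \<Rightarrow> complex fps" where
  "shift_var c = fps_X / (1 + fps_const c * fps_X)"

lemma shift_var_mult: "shift_var c * (1 + fps_const c * fps_X) = fps_X"
  using inverse_mult_eq_1[of "1 + fps_const c * fps_X"]
  by (simp add: shift_var_def fps_divide_unit mult.assoc)

lemma shift_var_nth_0: "fps_nth (shift_var c) 0 = 0"
  using arg_cong[OF shift_var_mult[of c], of "\<lambda>f. fps_nth f 0"] by simp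

lemma shift_var_nth_1: "fps_nth (shift_var c) (Suc 0) = 1"
  using arg_cong[OF shift_var_mult[of c], of "\<lambda>f. fps_nth f 1"] 
  by (simp add: fps_mult_nth shift_var_nth_0)

lemma shift_var_nonzero: "shift_var c \<noteq> 0"
proof
  assume "shift_var c = 0"
  with shift_var_nth_1[of c] show False by simp
qed

lemma subdegree_shift_var: "subdegree (shift_var c) = 1"
  by (rule subdegreeI) (auto simp: shift_var_nth_0 shift_var_nth_1)

text \<open>The expansion of the powers of \<open>(u + c)\<inverse>\<close> in \<open>u\<inverse>\<close>. Multiplying \<open>shift_var c ^ Suc n\<close> by \<open>1 + c X\<close>
  gives \<open>X * shift_var c ^ n\<close>, and on coefficients this becomes Pascal's rule. Writing both exponent and
  index as successors makes the binomial coefficients vanish outside the support.\<close>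

lemma shift_var_power_nth:
  "fps_nth (shift_var c ^ Suc n) (Suc m) = of_nat (m choose n) * (- c) ^ (m - n)"
proof (induction m arbitrary: n)
  have rec: "fps_nth (shift_var c ^ Suc n) (Suc m) =
      fps_nth (shift_var c ^ n) m - c * fps_nth (shift_var c ^ Suc n) m" for n m
  proof -
    have "shift_var c ^ Suc n * (1 + fps_const c * fps_X)
        = shift_var c ^ n * (shift_var c * (1 + fps_const c * fps_X))"
      by (simp only: power_Suc mult_ac)
    then have "fps_X * shift_var c ^ n = shift_var c ^ Suc n * (1 + fps_const c * fps_X)"
      by (simp only: shift_var_mult) (simp only: mult.commute)
    also have "\<dots> = shift_var c ^ Suc n + fps_const c * (fps_X * shift_var c ^ Suc n)"
      by (simp only: ring_distribs mult_1_right mult_1_left mult_ac)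
    finally have "fps_nth (fps_X * shift_var c ^ n) (Suc m) =
        fps_nth (shift_var c ^ Suc n + fps_const c * (fps_X * shift_var c ^ Suc n)) (Suc m)"
      by (rule arg_cong)
    then have "fps_nth (shift_var c ^ Suc n) (Suc m) + c * fps_nth (shift_var c ^ Suc n) m
        = fps_nth (shift_var c ^ n) m"
      by (simp del: power_Suc)
    then show ?thesis by (simp add: eq_diff_eq)
  qed
  {
    case 0
    have "fps_nth (shift_var c ^ Suc n) 0 = 0" for n
      by (simp add: shift_var_nth_0 fps_power_zeroth)
    then show ?case unfolding rec[of n 0]
      by (cases n) (simp_all add: fps_power_zeroth shift_var_nth_0)
  next
    case (Suc m)
    show ?case unfolding rec[of n "Suc m"] Suc.IH
    proof (cases n)
      case 0
      then show "fps_nth (shift_var c ^ n) (Suc m) - c * (of_nat (m choose n) * (- c) ^ (m - n)) =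
          of_nat (Suc m choose n) * (- c) ^ (Suc m - n)" by simp
    next
      case (Suc n')
      then show "fps_nth (shift_var c ^ n) (Suc m) - c * (of_nat (m choose n) * (- c) ^ (m - n)) =
          of_nat (Suc m choose n) * (- c) ^ (Suc m - n)"
      proof (cases "n \<le> m")
        case True
        then have "m - n' = Suc (m - Suc n')" using \<open>n = Suc n'\<close> by simp
        then have "(- c) ^ (m - n') = - c * (- c) ^ (m - Suc n')" by simp
        then show ?thesis using Suc.IH[of n'] \<open>n = Suc n'\<close>
          by (simp del: power_Suc add: algebra_simps)
      next
        case False
        then show ?thesis using Suc.IH[of n'] \<open>n = Suc n'\<close>
          by (simp del: power_Suc add: binomial_eq_0)
      qed
    qed
  }
qed

lemmas shift_var_simps = shift_var_nonzero shift_var_nth_0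

lemma shift_arg_eq: "shift_arg c f = fls_compose_fps f (shift_var c)"
  by (simp add: shift_arg_def shift_var_def)

lemma shift_arg_mult: "shift_arg c (f * g) = shift_arg c f * shift_arg c g"
  by (simp add: shift_arg_eq fls_compose_fps_mult shift_var_simps)

lemma shift_arg_powi: "shift_arg c (f powi k) = shift_arg c f powi k"
  by (simp add: shift_arg_eq fls_compose_fps_powi shift_var_simps)

lemma shift_arg_inverse: "shift_arg c (inverse f) = inverse (shift_arg c f)"
  by (simp add: shift_arg_eq fls_compose_fps_inverse shift_var_simps)

lemma shift_arg_uminus: "shift_arg c (- f) = - shift_arg c f"
  by (simp add: shift_arg_eq)

lemma shift_arg_X: "shift_arg c fls_X = fps_to_fls (shift_var c)" by (simp add: shift_arg_eq)

lemma shift_arg_fps_to_fls: "shift_arg c (fps_to_fls g) = fps_to_fls (g oo shift_var c)"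
  by (simp add: shift_arg_eq shift_var_simps)

lemma subdegree_shift_arg: "fls_subdegree (shift_arg c f) = fls_subdegree f"
  by (simp add: shift_arg_eq shift_var_simps subdegree_shift_var)

lemma monic_shift_arg: assumes "f \<in> monic_series" shows "shift_arg c f \<in> monic_series"
proof -
  obtain k g where f: "f = fls_X powi k * fps_to_fls g" "fps_nth g 0 = 1"
    using assms by (rule monic_cases)
  have "fps_to_fls (shift_var c) \<in> monic_series"
    using shift_var_nth_1[of c] by (simp add: monic_series_iff shift_var_nonzero fls_subdegree_fls_to_fps subdegree_shift_var)
  moreover have "fps_to_fls (g oo shift_var c) \<in> unit_series"
    using f(2) by (auto simp: unit_series_def)
  ultimately show ?thesis
    unfolding f(1) shift_arg_mult shift_arg_powi shift_arg_X shift_arg_fps_to_fls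
    by (intro monic_mult monic_powi) (simp_all add: unit_series_iff_monic)
qed

lemma unit_shift_arg: "f \<in> unit_series \<Longrightarrow> shift_arg c f \<in> unit_series"
  by (simp add: unit_series_iff_monic monic_shift_arg subdegree_shift_arg)

section \<open>The Borel transform of the logarithmic derivative\<close>

text \<open>The derivative is taken with respect to \<open>u\<close>: as \<open>X = u\<inverse>\<close>, the operator \<open>d/du\<close> is \<open>- X\<^sup>2 d/dX\<close>.\<close>

definition log_deriv :: "complex fls \<Rightarrow> complex fls" where
  "log_deriv f = - (fls_X ^ 2) * fls_deriv f / f"

text \<open>The formal Borel transform, applied to the part of the series in \<open>u\<inverse> \<complex>[[u\<inverse>]]\<close>.\<close>

definition borel :: "complex fls \<Rightarrow> complex fps" where
  "borel f = Abs_fps (\<lambda>n. fls_nth f (int n + 1) / fact n)"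

definition borel_log :: "complex fls \<Rightarrow> complex fps" where
  "borel_log f = borel (log_deriv f)"

lemma log_deriv_mult: "f \<noteq> 0 \<Longrightarrow> g \<noteq> 0 \<Longrightarrow> log_deriv (f * g) = log_deriv f + log_deriv g"
  by (simp add: log_deriv_def field_simps)

lemma log_deriv_1: "log_deriv 1 = 0" by (simp add: log_deriv_def)

lemma log_deriv_inverse: assumes "f \<noteq> 0" shows "log_deriv (inverse f) = - log_deriv f"
  using log_deriv_mult[OF assms, of "inverse f"] assms
  by (simp add: log_deriv_1 eq_neg_iff_add_eq_0 add.commute)

lemma log_deriv_power: "f \<noteq> 0 \<Longrightarrow> log_deriv (f ^ n) = of_nat n * log_deriv f"
  by (induction n) (simp_all add: log_deriv_1 log_deriv_mult algebra_simps)

lemma log_deriv_powi: "f \<noteq> 0 \<Longrightarrow> log_deriv (f powi k) = of_int k * log_deriv f"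
  by (simp add: power_int_def log_deriv_power log_deriv_inverse)

lemma log_deriv_X: "log_deriv fls_X = - fls_X"
  by (simp only: log_deriv_def fls_deriv_X power2_eq_square mult_1_right mult_minus_left[symmetric])
    (simp only: nonzero_mult_div_cancel_right fls_X_nonzero not_False_eq_True)

lemma fps_to_fls_unit_inverse:
  fixes g :: "complex fps"
  assumes "fps_nth g 0 = 1" shows "inverse (fps_to_fls g) = fps_to_fls (inverse g)"
proof -
  have "g * inverse g = 1" using assms by (simp add: inverse_mult_eq_1')
  then have "fps_to_fls g * fps_to_fls (inverse g) = 1" by (simp flip: fls_times_fps_to_fls)
  then show ?thesis by (rule inverse_unique)
qed

lemma log_deriv_unit:
  assumes "fps_nth g 0 = 1"
  shows "log_deriv (fps_to_fls g) = fps_to_fls (- (fps_X ^ 2) * fps_deriv g * inverse g)"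
  by (simp add: log_deriv_def divide_inverse fps_to_fls_unit_inverse[OF assms] fls_deriv_fps_to_fls
      fls_times_fps_to_fls fps_to_fls_power)

text \<open>The factor \<open>X ^ k\<close> contributes \<open>- k X\<close>, and a unit series contributes a multiple of
  \<open>X\<^sup>2\<close>; so the coefficient of \<open>X\<close> records the degree.\<close>

lemma log_deriv_monic:
  assumes "f \<in> monic_series"
  obtains h where "log_deriv f = fps_to_fls (fps_X * h)"
    and "fps_nth h 0 = - of_int (fls_subdegree f)"
proof -
  obtain k g where f: "f = fls_X powi k * fps_to_fls g" "fps_nth g 0 = 1"
    using assms by (rule monic_cases)
  have g: "fps_to_fls g \<noteq> 0" using f(2) by auto
  have "subdegree g = 0" using f(2) by (simp add: subdegree_eq_0_iff)
  then have k: "fls_subdegree f = k"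
    using g by (simp add: f(1) fls_subdegree_fls_to_fps fls_subdegree_mult_fls_X_intpow)
  let ?h = "- of_int k - fps_X * fps_deriv g * inverse g"
  have "log_deriv f = of_int k * (- fls_X) + fps_to_fls (- (fps_X ^ 2) * fps_deriv g * inverse g)"
    unfolding f(1) log_deriv_X[symmetric] log_deriv_unit[OF f(2), symmetric]
      log_deriv_powi[OF fls_X_nonzero, symmetric]
    using g by (intro log_deriv_mult) auto
  also have "\<dots> = fps_to_fls (fps_X * ?h)"
    by (simp add: algebra_simps power2_eq_square fls_times_fps_to_fls)
  finally show ?thesis by (rule that) (simp add: k)
qed

text \<open>For \<open>w = (u + c)\<inverse>\<close> this says that \<open>dw/du = - w\<^sup>2\<close>, that is, the substitution \<open>u \<mapsto> u + c\<close> commutes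
  with \<open>d/du\<close>.\<close>

lemma X2_shift_var_deriv: "fps_X ^ 2 * fps_deriv (shift_var c) = shift_var c ^ 2"
proof -
  let ?w = "shift_var c" and ?r = "1 + fps_const c * fps_X"
  have w: "?w * ?r = fps_X" by (rule shift_var_mult)
  have "fps_deriv (?w * ?r) = 1" by (simp only: w fps_deriv_fps_X)
  then have "fps_deriv ?w * ?r = 1 - fps_const c * ?w" by (simp add: algebra_simps)
  moreover have "(1 - fps_const c * ?w) * ?r = 1"
  proof -
    have "(1 - fps_const c * ?w) * ?r = ?r - fps_const c * (?w * ?r)" by (simp add: algebra_simps)
    then show ?thesis by (simp add: w)
  qed
  ultimately have "?w ^ 2 * (fps_deriv ?w * ?r * ?r) = ?w ^ 2" by simp
  moreover have "fps_X ^ 2 * fps_deriv ?w = ?w ^ 2 * (fps_deriv ?w * ?r * ?r)"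
  proof -
    have "fps_X ^ 2 * fps_deriv ?w = (?w * ?r) ^ 2 * fps_deriv ?w" by (simp only: w)
    then show ?thesis by (simp only: power2_eq_square mult_ac)
  qed
  ultimately show ?thesis by (simp only:)
qed

text \<open>Both sides turn products into sums, so it is enough to treat \<open>X\<close> and unit series; there the identity
  \<open>X\<^sup>2 w' = w\<^sup>2\<close> for the substituted series \<open>w\<close> turns the chain rule into the claim.\<close>

lemma log_deriv_shift_arg:
  assumes "f \<in> monic_series" shows "log_deriv (shift_arg c f) = shift_arg c (log_deriv f)"
proof -
  let ?w = "shift_var c"
  obtain k g where f: "f = fls_X powi k * fps_to_fls g" "fps_nth g 0 = 1"
    using assms by (rule monic_cases)
  have X: "log_deriv (shift_arg c fls_X) = shift_arg c (log_deriv fls_X)"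
  proof -
    have "fls_X ^ 2 * fls_deriv (fps_to_fls ?w) = fps_to_fls ?w ^ 2"
      using arg_cong[OF X2_shift_var_deriv[of c], of fps_to_fls]
      by (simp add: fls_times_fps_to_fls fps_to_fls_power fls_deriv_fps_to_fls)
    then show ?thesis using shift_var_nonzero[of c]
      by (simp add: log_deriv_X shift_arg_X shift_arg_eq, simp add: log_deriv_def power2_eq_square)
  qed
  have g: "log_deriv (shift_arg c (fps_to_fls g)) = shift_arg c (log_deriv (fps_to_fls g))"
  proof -
    have "fps_X ^ 2 * fps_deriv (g oo ?w) = (fps_X ^ 2 * fps_deriv g) oo ?w"
      using X2_shift_var_deriv[of c]
      by (simp add: fps_compose_deriv shift_var_nth_0 fps_compose_mult_distrib fps_compose_power[symmetric]
          mult.left_commute mult.commute)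
    moreover have "inverse (g oo ?w) = inverse g oo ?w"
      using f(2) by (simp add: fps_inverse_compose shift_var_nth_0)
    ultimately show ?thesis using f(2)
      by (simp add: shift_arg_fps_to_fls log_deriv_unit shift_arg_uminus fps_compose_mult_distrib shift_var_nth_0)
  qed
  have nz: "shift_arg c fls_X \<noteq> 0" "shift_arg c (fps_to_fls g) \<noteq> 0" "fps_to_fls g \<noteq> 0"
    using f(2) by (auto simp: shift_arg_eq fls_compose_fps_eq_0_iff shift_var_simps simp del: fls_compose_fps_to_fls fls_compose_fps_X)
  have "log_deriv (shift_arg c f) = of_int k * shift_arg c (log_deriv fls_X) + shift_arg c (log_deriv (fps_to_fls g))"
    unfolding f(1) shift_arg_mult shift_arg_powi using nz
    by (simp add: log_deriv_mult log_deriv_powi X g del: fls_X_power_int)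
  also have "\<dots> = shift_arg c (of_int k * log_deriv fls_X + log_deriv (fps_to_fls g))"
    by (simp add: shift_arg_eq fls_compose_fps_add fls_compose_fps_mult shift_var_simps)
  also have "\<dots> = shift_arg c (log_deriv f)"
    unfolding f(1) using nz by (simp add: log_deriv_mult log_deriv_powi del: fls_X_power_int)
  finally show ?thesis .
qed

lemma borel_X_mult: "fps_nth (borel (fps_to_fls (fps_X * h))) n = fps_nth h n / fact n"
  by (simp add: borel_def nat_add_distrib)

text \<open>The factorials in the Borel transform absorb the binomial coefficients of the powers of
  \<open>(u + c)\<inverse>\<close> and leave the convolution of the transform with the coefficients of \<open>exp(- c z)\<close>.\<close>

lemma borel_shift_arg:
  "borel (shift_arg c (fps_to_fls (fps_X * h))) = fps_exp (- c) * borel (fps_to_fls (fps_X * h))"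
proof (rule fps_ext)
  fix n
  have "fps_nth (borel (shift_arg c (fps_to_fls (fps_X * h)))) n =
      (\<Sum>i=0..Suc n. fps_nth (fps_X * h) i * fps_nth (shift_var c ^ i) (Suc n)) / fact n"
    by (simp add: borel_def shift_arg_fps_to_fls nat_add_distrib fps_compose_nth del: sum.cl_ivl_Suc)
  also have "\<dots> = (\<Sum>i=0..n. fps_nth h i * (of_nat (n choose i) * (- c) ^ (n - i)) / fact n)"
    by (subst sum.atLeast0_atMost_Suc_shift)
      (simp add: shift_var_power_nth sum_divide_distrib del: power_Suc)
  also have "\<dots> = (\<Sum>i=0..n. fps_nth h i / fact i * ((- c) ^ (n - i) / fact (n - i)))"
    by (rule sum.cong) (simp_all add: binomial_fact field_simps)
  also have "\<dots> = fps_nth (borel (fps_to_fls (fps_X * h)) * fps_exp (- c)) n"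
    unfolding fps_mult_nth borel_X_mult by simp
  finally show "fps_nth (borel (shift_arg c (fps_to_fls (fps_X * h)))) n =
      fps_nth (fps_exp (- c) * borel (fps_to_fls (fps_X * h))) n" by (simp add: mult.commute)
qed

lemma borel_log_shift_arg:
  assumes "f \<in> monic_series"
  shows "borel_log (shift_arg c f) = fps_exp (- c) * borel_log f"
proof -
  obtain h where "log_deriv f = fps_to_fls (fps_X * h)" using log_deriv_monic[OF assms] by metis
  then show ?thesis using borel_shift_arg[of c h]
    by (simp add: borel_log_def log_deriv_shift_arg[OF assms])
qed

lemma borel_add: "borel (f + g) = borel f + borel g"
  by (simp add: borel_def fps_eq_iff add_divide_distrib)

lemma borel_log_mult:
  "f \<in> monic_series \<Longrightarrow> g \<in> monic_series \<Longrightarrow> borel_log (f * g) = borel_log f + borel_log g"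
  by (simp add: borel_log_def log_deriv_mult monic_nonzero borel_add)

lemma borel_log_1: "borel_log 1 = 0"
  by (simp add: borel_log_def log_deriv_1 borel_def fps_eq_iff)

lemma borel_log_prod:
  "(\<And>k. k \<in> A \<Longrightarrow> F k \<in> monic_series) \<Longrightarrow> borel_log (prod F A) = (\<Sum>k\<in>A. borel_log (F k))"
  by (induction A rule: infinite_finite_induct) (simp_all add: borel_log_1 borel_log_mult monic_prod)

lemma borel_log_powi:
  assumes "f \<in> monic_series" shows "borel_log (f powi k) = of_int k * borel_log f"
proof -
  have "fls_nth (of_int k * F) n = of_int k * fls_nth F n" for F :: "complex fls" and n
    by (simp flip: fls_of_int)
  moreover have "fps_nth (of_int k * F) n = of_int k * fps_nth F n" for F :: "complex fps" and n
    by (simp flip: fps_of_int)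
  ultimately show ?thesis
    using assms by (simp add: borel_log_def log_deriv_powi monic_nonzero borel_def fps_eq_iff del: fls_X_power_int)
qed

lemma borel_log_inverse: "f \<in> monic_series \<Longrightarrow> borel_log (inverse f) = - borel_log f"
  using borel_log_powi[of f "-1"] by (simp add: power_int_minus)

lemma borel_log_nth_0:
  assumes "f \<in> monic_series" shows "fps_nth (borel_log f) 0 = of_int (deg_series f)"
proof -
  obtain h where "log_deriv f = fps_to_fls (fps_X * h)" "fps_nth h 0 = - of_int (fls_subdegree f)"
    using log_deriv_monic[OF assms] .
  then show ?thesis using borel_X_mult[of h 0] deg_series_monic[OF assms]
    by (simp add: borel_log_def)
qed

text \<open>The kernel is trivial: if the logarithmic derivative vanishes, then the series is constant, and a
  monic constant is 1.\<close>

lemma inj_on_borel_log: "inj_on borel_log monic_series"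
proof (rule inj_onI)
  fix f g assume fg: "f \<in> monic_series" "g \<in> monic_series" "borel_log f = borel_log g"
  define q where "q = f * inverse g"
  have q: "q \<in> monic_series" "borel_log q = 0"
    using fg by (simp_all add: q_def monic_mult monic_inverse borel_log_mult borel_log_inverse)
  obtain h where h: "log_deriv q = fps_to_fls (fps_X * h)" using log_deriv_monic[OF q(1)] by metis
  have "h = 0" using q(2) borel_X_mult[of h]
    by (simp add: borel_log_def h fps_eq_iff del: fls_times_fps_to_fls)
  then have "fls_deriv q = 0" using h monic_nonzero[OF q(1)] by (simp add: log_deriv_def)
  then obtain c where "q = fls_const c" using fls_deriv_eq_0_iff[of q] by auto
  then have "q = 1" using q(1) by (auto simp: monic_series_iff)
  then show "f = g" using monic_nonzero[OF fg(2)] by (simp add: q_def field_simps)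
qed


section \<open>Braid relations for pseudo-reflections\<close>

definition pseudo_reflection :: "('i \<Rightarrow> 'i \<Rightarrow> 'r::comm_ring_1) \<Rightarrow> 'i \<Rightarrow> ('i \<Rightarrow> 'r) \<Rightarrow> 'i \<Rightarrow> 'r" where
  "pseudo_reflection P j x = (\<lambda>i. x i - P j i * x j)"

lemma pseudo_reflection_braid_2:
  assumes "P i j = 0" "P j i = 0"
  shows "foldr (pseudo_reflection P) [i, j] x = foldr (pseudo_reflection P) [j, i] x"
  using assms by (simp add: pseudo_reflection_def fun_eq_iff)

text \<open>In the next three lemmas \<open>- p\<close> and \<open>- r\<close> are the eigenvalues of the two pseudo-reflections on the
  vectors that they subtract. The hypothesis on \<open>P i j * P j i\<close> fixes the trace of their product on
  the plane spanned by these vectors; together with the determinant \<open>p r\<close> this makes the third, second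
  and third power of the product, respectively, a scalar. All the other
  coordinates are covered by the same identity, in which \<open>P i l\<close> and \<open>P j l\<close> stay indeterminate.\<close>

lemma pseudo_reflection_braid_3:
  fixes P :: "'i \<Rightarrow> 'i \<Rightarrow> 'r::comm_ring_1"
  assumes "P i i = 1 + p" "P j j = 1 + p" "P i j * P j i = p"
  shows "foldr (pseudo_reflection P) [i, j, i] x = foldr (pseudo_reflection P) [j, i, j] x"
proof
  fix l
  show "foldr (pseudo_reflection P) [i, j, i] x l = foldr (pseudo_reflection P) [j, i, j] x l"
    unfolding foldr.simps o_def id_def pseudo_reflection_def assms(1,2) assms(3)[symmetric]
    by (simp add: algebra_simps)
qed

lemma pseudo_reflection_braid_4:
  fixes P :: "'i \<Rightarrow> 'i \<Rightarrow> 'r::comm_ring_1"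
  assumes "P i i = 1 + p" "P j j = 1 + r" "P i j * P j i = p + r"
  shows "foldr (pseudo_reflection P) [i, j, i, j] x = foldr (pseudo_reflection P) [j, i, j, i] x"
proof
  have p: "p = P i j * P j i - r" using assms(3) by simp
  fix l
  show "foldr (pseudo_reflection P) [i, j, i, j] x l = foldr (pseudo_reflection P) [j, i, j, i] x l"
    unfolding foldr.simps o_def id_def pseudo_reflection_def assms(1,2) p
    by (simp add: algebra_simps)
qed

lemma pseudo_reflection_braid_6:
  fixes P :: "'i \<Rightarrow> 'i \<Rightarrow> 'r::comm_ring_1"
  assumes "P i i = 1 + p" "P j j = 1 + r" "P i j * P j i = p + r + s" "s * s = p * r"
  shows "foldr (pseudo_reflection P) [i, j, i, j, i, j] x = foldr (pseudo_reflection P) [j, i, j, i, j, i] x"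
proof
  \<comment> \<open>Eliminating \<open>p\<close> leaves the single relation for \<open>s * s\<close>; it is used as a rewrite rule that
    lowers the degree in \<open>s\<close>, in both forms that occur in a sorted product.\<close>
  have p: "p = P i j * P j i - r - s" using assms(3) by simp
  have ss: "s * s = P i j * (P j i * r) - r * r - r * s"
    using assms(4) unfolding p by (simp add: algebra_simps)
  have ss': "s * (s * z) = P i j * (P j i * (r * z)) - r * (r * z) - r * (s * z)" for z
    using arg_cong[OF ss, of "\<lambda>y. y * z"] by (simp add: algebra_simps)
  fix l
  show "foldr (pseudo_reflection P) [i, j, i, j, i, j] x l = foldr (pseudo_reflection P) [j, i, j, i, j, i] x l"
    unfolding foldr.simps o_def id_def pseudo_reflection_def assms(1,2) p
    by (simp add: algebra_simps ss ss')
qed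

lemma eval_positive_word:
  assumes "group G" "\<forall>j. f j \<in> auto G" "x \<in> carrier G"
  shows "eval_word (AutoGroup G) f (map (\<lambda>i. (i, True)) js) x = foldr f js x"
proof -
  have "eval_word (AutoGroup G) f (map (\<lambda>i. (i, True)) js) x = foldr f js x \<and> foldr f js x \<in> carrier G"
  proof (induction js)
    case Nil
    show ?case using assms(3) by (simp add: one_AutoGroup)
  next
    case (Cons j js)
    have "f j \<in> auto G" using assms(2) by blast
    then show ?case
      using Cons.IH assms(3) by (simp add: mult_AutoGroup eval_word_auto[OF assms(1,2)] auto_closed)
  qed
  then show ?thesis ..
qed

abbreviation alternating_list :: "'i \<Rightarrow> 'i \<Rightarrow> nat \<Rightarrow> 'i list" where
  "alternating_list i j m \<equiv> map (\<lambda>k. if even k then i else j) [0..<m]"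

lemma alternating_word_eq: "alternating_word i j m = map (\<lambda>i. (i, True)) (alternating_list i j m)"
  by (simp add: alternating_word_def)

lemma alternating_list_eqs:
  "alternating_list i j 2 = [i, j]"
  "alternating_list i j 3 = [i, j, i]"
  "alternating_list i j 4 = [i, j, i, j]"
  "alternating_list i j 6 = [i, j, i, j, i, j]"
  by (simp_all add: upt_conv_Cons)

text \<open>Positivity of the quadratic form on the coordinate plane of \<open>i\<close> and \<open>j\<close>: at the vector with
  entries \<open>- a i j\<close> and \<open>2\<close> its value is \<open>2 d\<^sub>j (4 - a\<^sub>i\<^sub>j a\<^sub>j\<^sub>i)\<close>.\<close>

lemma simple_cartan_matrix_product_lt_4:
  assumes "simple_cartan_matrix a" "i \<noteq> j"
  shows "a i j * a j i < 4"
proof -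
  have diag: "a i i = 2" for i using assms(1) by (simp add: simple_cartan_matrix_def)
  obtain d where d: "symmetrizer a d" and pos: "\<forall>x::'a \<Rightarrow> real. x \<noteq> (\<lambda>_. 0) \<longrightarrow>
           (\<Sum>i\<in>UNIV. \<Sum>j\<in>UNIV. of_nat (d i) * of_int (a i j) * x i * x j) > 0"
    using assms(1) unfolding simple_cartan_matrix_def by (elim conjE exE)
  define x where "x k = (if k = i then - of_int (a i j) else if k = j then 2 else 0 :: real)" for k
  have sub: "(\<Sum>k\<in>UNIV. f k) = (\<Sum>k\<in>{i, j}. f k)" if "\<And>k. x k = 0 \<Longrightarrow> f k = 0" for f :: "'a \<Rightarrow> real"
  proof (rule sum.mono_neutral_right)
    show "\<forall>k\<in>UNIV - {i, j}. f k = 0" by (intro ballI that) (simp add: x_def)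
  qed simp_all
  have "(\<Sum>k\<in>UNIV. \<Sum>l\<in>UNIV. of_nat (d k) * of_int (a k l) * x k * x l)
      = (\<Sum>k\<in>{i, j}. \<Sum>l\<in>{i, j}. of_nat (d k) * of_int (a k l) * x k * x l)"
  proof -
    have "(\<Sum>l\<in>UNIV. of_nat (d k) * of_int (a k l) * x k * x l)
        = (\<Sum>l\<in>{i, j}. of_nat (d k) * of_int (a k l) * x k * x l)" for k
      by (rule sub) simp
    then have "(\<Sum>k\<in>UNIV. \<Sum>l\<in>UNIV. of_nat (d k) * of_int (a k l) * x k * x l)
        = (\<Sum>k\<in>UNIV. \<Sum>l\<in>{i, j}. of_nat (d k) * of_int (a k l) * x k * x l)"
      by (rule sum.cong[OF HOL.refl])
    also have "\<dots> = (\<Sum>k\<in>{i, j}. \<Sum>l\<in>{i, j}. of_nat (d k) * of_int (a k l) * x k * x l)"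
      by (rule sub) simp
    finally show ?thesis .
  qed
  moreover have "x \<noteq> (\<lambda>_. 0)" using assms(2) by (auto simp: x_def fun_eq_iff)
  ultimately have "0 < (\<Sum>k\<in>{i, j}. \<Sum>l\<in>{i, j}. of_nat (d k) * of_int (a k l) * x k * x l)"
    using spec[OF pos, of x] by (simp only: simp_thms)
  also have "\<dots> = 8 * d j - 2 * d j * a j i * a i j"
    using assms(2) by (simp add: x_def diag algebra_simps)
  finally have "0 < real (d j) * (8 - 2 * (a i j * a j i))" by (simp add: algebra_simps)
  moreover have "real (d j) > 0" using d by (simp add: symmetrizer_def)
  ultimately have "0 < 8 - 2 * (real_of_int (a i j * a j i))"
    by (simp add: zero_less_mult_iff)
  then show ?thesis by linarith
qed

lemma simple_cartan_matrix_cases: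
  assumes a: "simple_cartan_matrix a" "i \<noteq> j"
  obtains "a i j = 0" "a j i = 0" "braid_order a i j = 2"
  | "a i j = -1" "a j i = -1" "braid_order a i j = 3"
  | "a i j = -1" "a j i = -2" "braid_order a i j = 4"
  | "a i j = -2" "a j i = -1" "braid_order a i j = 4"
  | "a i j = -1" "a j i = -3" "braid_order a i j = 6"
  | "a i j = -3" "a j i = -1" "braid_order a i j = 6"
proof -
  have z: "a i j = 0 \<longleftrightarrow> a j i = 0" and np: "a i j \<le> 0" "a j i \<le> 0"
    using a by (auto simp: simple_cartan_matrix_def)
  show ?thesis
  proof (cases "a i j = 0")
    case True
    then show ?thesis using z by (intro that(1)) (auto simp: braid_order_def)
  next
    case False
    define u v where "u = - a i j" and "v = - a j i"
    have uv: "u \<ge> 1" "v \<ge> 1" "u * v < 4"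
      using False z np simple_cartan_matrix_product_lt_4[OF a] by (auto simp: u_def v_def)
    have "u \<le> u * v" "v \<le> u * v" using uv by (simp_all add: mult_le_cancel_left1 mult_le_cancel_right1)
    then have "u = 1 \<or> u = 2 \<or> u = 3" "v = 1 \<or> v = 2 \<or> v = 3" using uv by linarith+
    with uv(3) consider "u = 1" "v = 1" | "u = 1" "v = 2" | "u = 2" "v = 1" | "u = 1" "v = 3"
      | "u = 3" "v = 1" by fastforce
    then show ?thesis
    proof cases
      case 1
      then have "a i j = - u" "a j i = - v" "u = 1" "v = 1" by (simp_all add: u_def v_def)
      then show ?thesis by (intro that(2)) (simp_all add: braid_order_def)
    next
      case 2
      then have "a i j = - u" "a j i = - v" "u = 1" "v = 2" by (simp_all add: u_def v_def)
      then show ?thesis by (intro that(3)) (simp_all add: braid_order_def)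
    next
      case 3
      then have "a i j = - u" "a j i = - v" "u = 2" "v = 1" by (simp_all add: u_def v_def)
      then show ?thesis by (intro that(4)) (simp_all add: braid_order_def)
    next
      case 4
      then have "a i j = - u" "a j i = - v" "u = 1" "v = 3" by (simp_all add: u_def v_def)
      then show ?thesis by (intro that(5)) (simp_all add: braid_order_def)
    next
      case 5
      then have "a i j = - u" "a j i = - v" "u = 3" "v = 1" by (simp_all add: u_def v_def)
      then show ?thesis by (intro that(6)) (simp_all add: braid_order_def)
    qed
  qed
qed

section \<open>Reflections of tuples of series\<close>

text \<open>The common form of the generators on unit tuples and of their lifts to monic tuples. The shift
  step \<open>c\<close> and the number \<open>m\<close> of factors may depend on the component, since the former use
  \<open>d\<^sub>j, a\<^sub>j\<^sub>i\<close> and the latter \<open>d\<^sub>i, a\<^sub>i\<^sub>j\<close>.\<close>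

definition series_reflection ::
  "('i \<Rightarrow> complex) \<Rightarrow> ('i \<Rightarrow> int) \<Rightarrow> 'i \<Rightarrow> ('i \<Rightarrow> complex fls) \<Rightarrow> 'i \<Rightarrow> complex fls" where
  "series_reflection c m j \<xi> = (\<lambda>i. \<xi> i * (\<Prod>k<nat \<bar>m i\<bar>.
     shift_arg (- (c i / 2 * of_int (\<bar>m i\<bar> - 2 * int k))) (\<xi> j) powi ((-1) ^ of_bool (i = j))))"

text \<open>Up to a factor \<open>exp(c z / 2)\<close> this is the quantum integer of \<open>\<bar>m\<bar>\<close> at \<open>q = exp(c z / 2)\<close>.\<close>

definition exp_sum :: "complex \<Rightarrow> int \<Rightarrow> complex fps" where
  "exp_sum c m = (\<Sum>k<nat \<bar>m\<bar>. fps_exp (c / 2 * of_int (\<bar>m\<bar> - 2 * int k)))"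

definition series_cartan ::
  "('i \<Rightarrow> complex) \<Rightarrow> ('i \<Rightarrow> int) \<Rightarrow> 'i \<Rightarrow> 'i \<Rightarrow> complex fps" where
  "series_cartan c m j i = (if i = j then exp_sum (c i) (m i) else - exp_sum (c i) (m i))"

lemma borel_log_series_reflection:
  assumes "\<And>i. \<xi> i \<in> monic_series"
  shows "borel_log (series_reflection c m j \<xi> i) =
    borel_log (\<xi> i) - series_cartan c m j i * borel_log (\<xi> j)"
proof -
  have "borel_log (series_reflection c m j \<xi> i) = borel_log (\<xi> i) +
      (\<Sum>k<nat \<bar>m i\<bar>. of_int ((-1) ^ of_bool (i = j)) *
        (fps_exp (c i / 2 * of_int (\<bar>m i\<bar> - 2 * int k)) * borel_log (\<xi> j)))"
    using assms unfolding series_reflection_def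
    by (simp add: borel_log_mult borel_log_prod borel_log_powi borel_log_shift_arg
        monic_prod monic_powi monic_shift_arg)
  then show ?thesis
    by (simp add: series_cartan_def exp_sum_def sum_distrib_right sum_negf)
qed

lemma exp_sum_telescope:
  "(fps_exp (- c) - 1) * exp_sum c m
    = fps_exp (- (c / 2 * of_int \<bar>m\<bar>)) - fps_exp (c / 2 * of_int \<bar>m\<bar>)"
proof -
  define F where "F k = fps_exp (c / 2 * of_int (\<bar>m\<bar> - 2 * int k))" for k :: nat
  have "fps_exp (- c) * F k = F (Suc k)" for k
    unfolding F_def by (simp add: field_simps flip: fps_exp_add_mult)
  moreover have "exp_sum c m = (\<Sum>k<nat \<bar>m\<bar>. F k)" by (simp only: exp_sum_def F_def)
  ultimately have "(fps_exp (- c) - 1) * exp_sum c m = (\<Sum>k<nat \<bar>m\<bar>. F (Suc k) - F k)"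
    by (simp add: sum_distrib_left left_diff_distrib)
  also have "\<dots> = F (nat \<bar>m\<bar>) - F 0" by (rule sum_lessThan_telescope)
  finally show ?thesis by (simp add: F_def field_simps)
qed

lemma exp_sum_nth_0: "fps_nth (exp_sum c m) 0 = of_int \<bar>m\<bar>"
  by (simp add: exp_sum_def fps_sum_nth)

abbreviation fls_mult_group :: "complex fls set \<Rightarrow> complex fls monoid" where
  "fls_mult_group U \<equiv> \<lparr>carrier = U, monoid.mult = (*), one = 1\<rparr>"

lemma series_sets_closed:
  assumes "U \<in> {unit_series, monic_series}"
  shows "1 \<in> U" "f \<in> U \<Longrightarrow> g \<in> U \<Longrightarrow> f * g \<in> U" "f \<in> U \<Longrightarrow> inverse f \<in> U"
    "f \<in> U \<Longrightarrow> shift_arg c f \<in> U" "f \<in> U \<Longrightarrow> f powi n \<in> U" "f \<in> U \<Longrightarrow> f \<in> monic_series"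
  using assms
  by (auto simp: monic_1 monic_mult monic_inverse monic_shift_arg monic_powi unit_mult unit_inverse
      unit_shift_arg unit_powi unit_series_iff_monic[of 1]) (simp_all add: unit_series_iff_monic)

lemma series_prod_closed:
  assumes "U \<in> {unit_series, monic_series}" "\<And>k. k \<in> A \<Longrightarrow> F k \<in> U"
  shows "prod F A \<in> U"
  using assms(2) by (induction A rule: infinite_finite_induct) (auto simp: series_sets_closed[OF assms(1)])

lemma comm_group_fls_mult_group:
  assumes "U \<in> {unit_series, monic_series}" shows "comm_group (fls_mult_group U)"
proof (rule comm_groupI)
  fix f assume "f \<in> carrier (fls_mult_group U)"
  then have "inverse f \<in> U" "inverse f * f = 1"
    using series_sets_closed[OF assms] monic_nonzero by auto
  then show "\<exists>g\<in>carrier (fls_mult_group U). g \<otimes>\<^bsub>fls_mult_group U\<^esub> f = \<one>\<^bsub>fls_mult_group U\<^esub>"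
    by auto
qed (simp_all add: series_sets_closed[OF assms] mult_ac)

text \<open>For \<open>m j = 2\<close> the two shifts in the \<open>j\<close>-th component are by \<open>- c j\<close> and \<open>0\<close>. The unshifted factor
  cancels, and the component is sent to the inverse of its shift, which is an automorphism.\<close>

lemma series_reflection_auto:
  assumes U: "U \<in> {unit_series, monic_series}" and "m j = 2"
  defines "P \<equiv> product_group UNIV (\<lambda>_. fls_mult_group U)"
  shows "restrict (series_reflection c m j) (carrier P) \<in> auto P"
proof -
  define h where "h i f = (\<Prod>k<nat \<bar>m i\<bar>.
     shift_arg (- (c i / 2 * of_int (\<bar>m i\<bar> - 2 * int k))) f powi ((-1) ^ of_bool (i = j)))" for i f
  define g where "g f = inverse (shift_arg (- c j) f)" for f
  note cl = series_sets_closed[OF U]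
  have hU: "h i f \<in> U" if "f \<in> U" for i f
    unfolding h_def using that by (intro series_prod_closed[OF U] cl)
  have h: "h i \<in> hom (fls_mult_group U) (fls_mult_group U)" for i
    by (rule homI) (auto simp: hU, auto simp: h_def shift_arg_mult power_int_mult_distrib prod.distrib)
  have gU: "g f \<in> U" if "f \<in> U" for f unfolding g_def using that by (intro cl)
  have g: "g \<in> hom (fls_mult_group U) (fls_mult_group U)"
    by (rule homI) (auto simp: gU, auto simp: g_def shift_arg_mult)
  have shift_shift: "shift_arg b (shift_arg (- b) f) = f" if "f \<in> U" for f b
  proof (rule inj_onD[OF inj_on_borel_log])
    show "borel_log (shift_arg b (shift_arg (- b) f)) = borel_log f"
      using that by (simp add: borel_log_shift_arg cl flip: mult.assoc fps_exp_add_mult)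
  qed (use that in \<open>auto intro: cl\<close>)
  have "bij_betw g U U"
    by (rule bij_betw_byWitness[where f' = "\<lambda>f. inverse (shift_arg (c j) f)"])
       (auto simp: g_def shift_arg_inverse shift_shift shift_shift[of _ "- c j", simplified] intro!: cl)
  then have g_bij: "bij_betw g (carrier (fls_mult_group U)) (carrier (fls_mult_group U))" by simp
  have gh: "f * h j f = g f" if "f \<in> U" for f
  proof (rule inj_onD[OF inj_on_borel_log])
    have "borel_log (f * h j f) = borel_log f - (fps_exp (c j) + 1) * borel_log f"
      using borel_log_series_reflection[of "\<lambda>_. f" c m j j] that assms(2)
      by (simp add: series_reflection_def h_def series_cartan_def exp_sum_def numeral_2_eq_2 cl)
    also have "\<dots> = borel_log (g f)"
      using that by (simp add: g_def borel_log_inverse borel_log_shift_arg cl algebra_simps)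
    finally show "borel_log (f * h j f) = borel_log (g f)" .
  qed (use that in \<open>auto intro: cl hU gU\<close>)
  have "restrict (series_reflection c m j) (carrier P)
      = (\<lambda>x\<in>carrier P. \<lambda>i. if i = j then g (x j) else x i \<otimes>\<^bsub>fls_mult_group U\<^esub> h i (x j))"
  proof (rule restrict_ext, rule ext)
    fix x i assume "x \<in> carrier P"
    then have "x j \<in> U" by (auto simp: P_def)
    then show "series_reflection c m j x i
        = (if i = j then g (x j) else x i \<otimes>\<^bsub>fls_mult_group U\<^esub> h i (x j))"
      using gh by (simp add: series_reflection_def h_def)
  qed
  then show ?thesis
    unfolding P_def using transvection_auto[OF comm_group_fls_mult_group[OF U] g g_bij h] by simp
qed


section \<open>The braid relations for the action on unit series\<close>

text \<open>The matrix \<open>P\<close> of the generators on unit tuples in the coordinates \<open>borel_log\<close>.\<close>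

definition yangian_cartan ::
  "('i \<Rightarrow> 'i \<Rightarrow> int) \<Rightarrow> ('i \<Rightarrow> nat) \<Rightarrow> complex \<Rightarrow> 'i \<Rightarrow> 'i \<Rightarrow> complex fps" where
  "yangian_cartan a d hbar j = series_cartan (\<lambda>_. hbar * of_nat (d j)) (a j) j"

lemma exp_sum_eqs:
  "exp_sum c 0 = 0"
  "exp_sum c 2 = 1 + fps_exp c"
  "exp_sum c (- 1) = fps_exp (c / 2)"
  "exp_sum c (- 2) = fps_exp c + 1"
  "exp_sum c (- 3) = fps_exp (c * 3 / 2) + fps_exp (c / 2) + fps_exp (- (c / 2))"
  by (simp_all add: exp_sum_def eval_nat_numeral)

lemma yangian_cartan_diag: "a j j = 2 \<Longrightarrow> yangian_cartan a d hbar j j = 1 + fps_exp (hbar * of_nat (d j))"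
  by (simp add: yangian_cartan_def series_cartan_def exp_sum_eqs)

lemma yangian_cartan_offdiag:
  "i \<noteq> j \<Longrightarrow> yangian_cartan a d hbar j i = - exp_sum (hbar * of_nat (d j)) (a j i)"
  by (simp add: yangian_cartan_def series_cartan_def)

lemma symmetrizer_complex:
  assumes "symmetrizer a d"
  shows "of_nat (d i) * of_int (a i j) = (of_nat (d j) * of_int (a j i) :: complex)"
proof -
  have "int (d i) * a i j = int (d j) * a j i" using assms by (simp add: symmetrizer_def)
  from arg_cong[OF this, of "of_int :: int \<Rightarrow> complex"] show ?thesis by simp
qed

text \<open>If \<open>a i j = - 1\<close> then \<open>d\<^sub>i = - d\<^sub>j a\<^sub>j\<^sub>i\<close>, and all exponents are multiples of \<open>\<hbar> d\<^sub>j / 2\<close>. The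
  last summand for \<open>a j i = - 3\<close> is written as the geometric mean of the other two, which is the form
  that the braid relation of length 6 requires.\<close>

lemma yangian_cartan_product:
  assumes "symmetrizer a d" "i \<noteq> j" "a i j = - 1"
  shows "a j i = - 1 \<Longrightarrow> yangian_cartan a d hbar i j * yangian_cartan a d hbar j i
      = fps_exp (hbar * of_nat (d i))"
    and "a j i = - 2 \<Longrightarrow> yangian_cartan a d hbar i j * yangian_cartan a d hbar j i
      = fps_exp (hbar * of_nat (d i)) + fps_exp (hbar * of_nat (d j))"
    and "a j i = - 3 \<Longrightarrow> yangian_cartan a d hbar i j * yangian_cartan a d hbar j i
      = fps_exp (hbar * of_nat (d i)) + fps_exp (hbar * of_nat (d j))
        + fps_exp (hbar * of_nat (d i) / 2 + hbar * of_nat (d j) / 2)"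
proof -
  have d: "(of_nat (d i) :: complex) = - (of_nat (d j) * of_int (a j i))"
    using symmetrizer_complex[OF assms(1), of i j] assms(3)
    by (simp add: eq_neg_iff_add_eq_0 neg_eq_iff_add_eq_0 add.commute)
  note eqs = yangian_cartan_offdiag[OF assms(2)] yangian_cartan_offdiag[OF assms(2)[symmetric]]
    assms(3) exp_sum_eqs d
  show "yangian_cartan a d hbar i j * yangian_cartan a d hbar j i
      = fps_exp (hbar * of_nat (d i))" if "a j i = - 1"
    unfolding eqs that by (simp flip: fps_exp_add_mult)
  show "yangian_cartan a d hbar i j * yangian_cartan a d hbar j i
      = fps_exp (hbar * of_nat (d i)) + fps_exp (hbar * of_nat (d j))" if "a j i = - 2"
    unfolding eqs that by (simp add: algebra_simps flip: fps_exp_add_mult)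
  show "yangian_cartan a d hbar i j * yangian_cartan a d hbar j i
      = fps_exp (hbar * of_nat (d i)) + fps_exp (hbar * of_nat (d j))
        + fps_exp (hbar * of_nat (d i) / 2 + hbar * of_nat (d j) / 2)" if "a j i = - 3"
    unfolding eqs that by (simp add: algebra_simps flip: fps_exp_add_mult)
qed

lemma yangian_cartan_braid:
  assumes a: "simple_cartan_matrix a" and d: "symmetrizer a d" and ij: "i \<noteq> j"
  shows "foldr (pseudo_reflection (yangian_cartan a d hbar)) (alternating_list i j (braid_order a i j)) x =
    foldr (pseudo_reflection (yangian_cartan a d hbar)) (alternating_list j i (braid_order a i j)) x"
proof -
  have diag: "yangian_cartan a d hbar k k = 1 + fps_exp (hbar * of_nat (d k))" for k
    using a by (intro yangian_cartan_diag) (simp add: simple_cartan_matrix_def)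
  note prod = yangian_cartan_product[OF d, where hbar = hbar]
  have s: "fps_exp (hbar * of_nat (d i) / 2 + hbar * of_nat (d j) / 2) *
      fps_exp (hbar * of_nat (d i) / 2 + hbar * of_nat (d j) / 2) =
      fps_exp (hbar * of_nat (d i)) * fps_exp (hbar * of_nat (d j))"
    by (simp flip: fps_exp_add_mult)
  show ?thesis
  proof (rule simple_cartan_matrix_cases[OF a ij])
    assume "a i j = 0" "a j i = 0" and m: "braid_order a i j = 2"
    then show ?thesis unfolding m alternating_list_eqs
      by (intro pseudo_reflection_braid_2)
        (simp_all add: yangian_cartan_offdiag[OF ij] yangian_cartan_offdiag[OF ij[symmetric]] exp_sum_eqs)
  next
    assume aij: "a i j = - 1" "a j i = - 1" and m: "braid_order a i j = 3"
    have "d i = d j" using d aij unfolding symmetrizer_def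
      by (metis mult_minus1_right neg_equal_iff_equal of_nat_eq_iff)
    then show ?thesis unfolding m alternating_list_eqs
      by (intro pseudo_reflection_braid_3[OF diag _ prod(1)[OF ij aij]]) (simp add: diag)
  next
    assume aij: "a i j = - 1" "a j i = - 2" and m: "braid_order a i j = 4"
    show ?thesis unfolding m alternating_list_eqs
      by (rule pseudo_reflection_braid_4[OF diag diag prod(2)[OF ij aij]])
  next
    assume aij: "a i j = - 2" "a j i = - 1" and m: "braid_order a i j = 4"
    show ?thesis unfolding m alternating_list_eqs
      by (rule pseudo_reflection_braid_4[OF diag diag prod(2)[OF ij[symmetric] aij(2,1)], symmetric])
  next
    assume aij: "a i j = - 1" "a j i = - 3" and m: "braid_order a i j = 6"
    show ?thesis unfolding m alternating_list_eqs
      by (rule pseudo_reflection_braid_6[OF diag diag prod(3)[OF ij aij] s])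
  next
    assume aij: "a i j = - 3" "a j i = - 1" and m: "braid_order a i j = 6"
    show ?thesis unfolding m alternating_list_eqs
      by (rule pseudo_reflection_braid_6[OF diag diag prod(3)[OF ij[symmetric] aij(2,1)], symmetric])
        (use s in \<open>simp add: add.commute mult.commute\<close>)
  qed
qed

abbreviation unit_generator_auto ::
  "('i \<Rightarrow> 'i \<Rightarrow> int) \<Rightarrow> ('i \<Rightarrow> nat) \<Rightarrow> complex \<Rightarrow> 'i \<Rightarrow> ('i \<Rightarrow> complex fls) \<Rightarrow> 'i \<Rightarrow> complex fls" where
  "unit_generator_auto a d hbar j \<equiv> restrict (unit_generator a d hbar j) (carrier unit_group)"

lemma unit_generator_eq:
  "unit_generator a d hbar j = series_reflection (\<lambda>_. hbar * of_nat (d j)) (a j) j"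
  by (intro ext) (simp add: unit_generator_def series_reflection_def)

lemma carrier_unit_group: "\<xi> \<in> carrier unit_group \<longleftrightarrow> (\<forall>i. \<xi> i \<in> unit_series)"
  by (auto simp: unit_group_def PiE_UNIV_domain)

lemma unit_group_monic: "\<xi> \<in> carrier unit_group \<Longrightarrow> \<xi> i \<in> monic_series"
  by (simp add: carrier_unit_group unit_series_iff_monic)

lemma carrier_monic_group: "\<xi> \<in> carrier monic_group \<longleftrightarrow> (\<forall>i. \<xi> i \<in> monic_series)"
  by (auto simp: monic_group_def PiE_UNIV_domain)

lemma group_unit_group: "group unit_group"
  unfolding unit_group_def
  using comm_group_fls_mult_group[of unit_series] by (intro product_group) (simp add: comm_group.axioms(2))

lemma group_monic_group: "group monic_group"
  unfolding monic_group_def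
  using comm_group_fls_mult_group[of monic_series] by (intro product_group) (simp add: comm_group.axioms(2))

lemma unit_generator_auto:
  "a j j = 2 \<Longrightarrow> unit_generator_auto a d hbar j \<in> auto unit_group"
  unfolding unit_generator_eq unit_group_def by (rule series_reflection_auto) simp_all

text \<open>The coordinates \<open>borel_log\<close> are injective and turn the generators into the pseudo-reflections
  of \<open>yangian_cartan\<close>. Since both braid words are positive, no inverses have to be translated.\<close>

lemma braid_relations_unit_generator:
  fixes a :: "'i::finite \<Rightarrow> 'i \<Rightarrow> int"
  assumes a: "simple_cartan_matrix a" and d: "symmetrizer a d"
  shows "braid_relations a (AutoGroup unit_group) (unit_generator_auto a d hbar)"
proof -
  let ?f = "unit_generator_auto a d hbar" and ?P = "yangian_cartan a d hbar"
  have auto: "\<forall>j. ?f j \<in> auto unit_group"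
    using a by (intro allI unit_generator_auto) (simp add: simple_cartan_matrix_def)
  have fold: "foldr ?f js \<xi> \<in> carrier unit_group \<and>
      (\<lambda>i. borel_log (foldr ?f js \<xi> i)) = foldr (pseudo_reflection ?P) js (\<lambda>i. borel_log (\<xi> i))"
    if "\<xi> \<in> carrier unit_group" for js and \<xi> :: "'i \<Rightarrow> complex fls"
  proof (induction js)
    case Nil
    show ?case using that by simp
  next
    case (Cons j js)
    let ?\<eta> = "foldr ?f js \<xi>"
    have "?\<eta> i \<in> monic_series" for i
      by (rule unit_group_monic[OF conjunct1[OF Cons.IH]])
    from borel_log_series_reflection[of ?\<eta>, OF this]
    have "(\<lambda>i. borel_log (?f j ?\<eta> i)) = pseudo_reflection ?P j (\<lambda>i. borel_log (?\<eta> i))"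
      using conjunct1[OF Cons.IH]
      by (simp only: restrict_apply' unit_generator_eq pseudo_reflection_def yangian_cartan_def)
    moreover have "?f j ?\<eta> \<in> carrier unit_group"
      by (rule auto_closed[OF spec[OF auto] conjunct1[OF Cons.IH]])
    ultimately show ?case using conjunct2[OF Cons.IH] by (simp only: foldr_Cons o_apply)
  qed
  show ?thesis
    unfolding braid_relations_AutoGroup_iff[OF group_unit_group auto]
  proof (intro allI impI)
    fix i j :: 'i and \<xi> :: "'i \<Rightarrow> complex fls" assume ij: "i \<noteq> j" and \<xi>: "\<xi> \<in> carrier unit_group"
    let ?v = "alternating_list i j (braid_order a i j)" and ?w = "alternating_list j i (braid_order a i j)"
    have "(\<lambda>l. borel_log (foldr ?f ?v \<xi> l)) = (\<lambda>l. borel_log (foldr ?f ?w \<xi> l))"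
      unfolding conjunct2[OF fold[OF \<xi>]] by (rule yangian_cartan_braid[OF a d ij])
    then have "borel_log (foldr ?f ?v \<xi> l) = borel_log (foldr ?f ?w \<xi> l)" for l by meson
    moreover have "foldr ?f js \<xi> l \<in> monic_series" for js l
      by (rule unit_group_monic[OF conjunct1[OF fold[OF \<xi>]]])
    ultimately have "foldr ?f ?v \<xi> = foldr ?f ?w \<xi>"
      by (intro ext inj_onD[OF inj_on_borel_log])
    then show "eval_word (AutoGroup unit_group) ?f (alternating_word i j (braid_order a i j)) \<xi> =
        eval_word (AutoGroup unit_group) ?f (alternating_word j i (braid_order a i j)) \<xi>"
      unfolding alternating_word_eq eval_positive_word[OF group_unit_group auto \<xi>] .
  qed
qed

section \<open>The action on monic series\<close>

text \<open>For \<open>i \<noteq> j\<close>, the quotient \<open>\<rho>\<close> of the \<open>i\<close>-th components after and before the lift has to solve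
  \<open>\<rho>(u + \<hbar> d\<^sub>i) / \<rho>(u) = \<Prod>\<^sub>k \<xi>\<^sub>j(u - \<dots>)\<close> for \<open>\<xi>\<^sub>j(u) = \<mu>\<^sub>j(u + \<hbar> d\<^sub>j) / \<mu>\<^sub>j(u)\<close>. The
  product on the right telescopes to a quotient of two shifts of \<open>\<mu>\<^sub>j\<close> that differ by
  \<open>\<hbar> d\<^sub>j \<bar>a\<^sub>j\<^sub>i\<bar> = \<hbar> d\<^sub>i \<bar>a\<^sub>i\<^sub>j\<bar>\<close>, and such a quotient is again a telescoping product, in steps of \<open>\<hbar> d\<^sub>i\<close>.\<close>

definition monic_generator ::
  "('i \<Rightarrow> 'i \<Rightarrow> int) \<Rightarrow> ('i \<Rightarrow> nat) \<Rightarrow> complex \<Rightarrow> 'i \<Rightarrow> ('i \<Rightarrow> complex fls) \<Rightarrow> 'i \<Rightarrow> complex fls" where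
  "monic_generator a d hbar j =
     restrict (series_reflection (\<lambda>i. hbar * of_nat (d i)) (\<lambda>i. a i j) j) (carrier monic_group)"

lemma monic_generator_auto:
  "a j j = 2 \<Longrightarrow> monic_generator a d hbar j \<in> auto monic_group"
  unfolding monic_generator_def monic_group_def by (rule series_reflection_auto) simp_all

lemma q2D_quotient_unit_group:
  assumes "\<mu> \<in> carrier monic_group" shows "q2D_quotient d hbar \<mu> \<in> carrier unit_group"
  unfolding carrier_unit_group
proof
  fix i
  have \<mu>: "\<mu> i \<in> monic_series" using assms by (simp add: carrier_monic_group)
  then have "shift_arg (hbar * of_nat (d i)) (\<mu> i) * inverse (\<mu> i) \<in> unit_series"
    using monic_nonzero[OF \<mu>] monic_nonzero[OF monic_shift_arg[OF \<mu>]]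
    by (simp add: unit_series_iff_monic monic_mult monic_shift_arg monic_inverse
        subdegree_shift_arg fls_inverse_subdegree)
  then show "q2D_quotient d hbar \<mu> i \<in> unit_series"
    by (simp add: q2D_quotient_def q2D_def divide_inverse)
qed

lemma borel_log_q2D_quotient:
  assumes "\<mu> \<in> carrier monic_group"
  shows "borel_log (q2D_quotient d hbar \<mu> i) =
    (fps_exp (- (hbar * of_nat (d i))) - 1) * borel_log (\<mu> i)"
  using assms unfolding q2D_quotient_def q2D_def divide_inverse
  by (simp add: carrier_monic_group borel_log_mult borel_log_shift_arg borel_log_inverse
      monic_shift_arg monic_inverse left_diff_distrib)

lemma inj_on_q2D_quotient:
  assumes "hbar \<noteq> 0" and d: "\<And>i. d i > 0"
  shows "inj_on (q2D_quotient d hbar) (carrier monic_group)"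
proof (rule inj_onI)
  fix \<mu> \<nu> :: "'a \<Rightarrow> complex fls"
  assume \<mu>: "\<mu> \<in> carrier monic_group" and \<nu>: "\<nu> \<in> carrier monic_group"
    and eq: "q2D_quotient d hbar \<mu> = q2D_quotient d hbar \<nu>"
  show "\<mu> = \<nu>"
  proof
    fix i
    have "fps_exp (- (hbar * of_nat (d i))) - 1 \<noteq> 0" using assms(1) d[of i] by simp
    moreover have "(fps_exp (- (hbar * of_nat (d i))) - 1) * borel_log (\<mu> i) =
        (fps_exp (- (hbar * of_nat (d i))) - 1) * borel_log (\<nu> i)"
      by (simp only: eq flip: borel_log_q2D_quotient[OF \<mu>] borel_log_q2D_quotient[OF \<nu>])
    ultimately have "borel_log (\<mu> i) = borel_log (\<nu> i)" by (simp only: mult_cancel_left simp_thms)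
    then show "\<mu> i = \<nu> i"
      using \<mu> \<nu> by (intro inj_onD[OF inj_on_borel_log]) (simp_all add: carrier_monic_group)
  qed
qed

text \<open>In coordinates, the claim compares \<open>exp(- \<hbar> d\<^sub>i z) - 1\<close> times one sum of exponentials with
  \<open>exp(- \<hbar> d\<^sub>j z) - 1\<close> times the other; both telescope to the same difference of exponentials.\<close>

lemma q2D_quotient_monic_generator:
  assumes d: "symmetrizer a d" and diag: "\<And>j. a j j = 2" and \<mu>: "\<mu> \<in> carrier monic_group"
  shows "q2D_quotient d hbar (monic_generator a d hbar j \<mu>) =
    unit_generator_auto a d hbar j (q2D_quotient d hbar \<mu>)"
proof
  fix i
  let ?q = "q2D_quotient d hbar" and ?c = "\<lambda>i. hbar * of_nat (d i)"
  let ?E = "\<lambda>i. fps_exp (- ?c i) - 1"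
  have gen: "monic_generator a d hbar j \<mu> \<in> carrier monic_group"
    using monic_generator_auto[of a j, OF diag] \<mu> by (rule auto_closed)
  have q: "?q \<mu> \<in> carrier unit_group" using \<mu> by (rule q2D_quotient_unit_group)
  have "?c i * of_int \<bar>a i j\<bar> = ?c j * of_int \<bar>a j i\<bar>"
  proof -
    have "int (d i) * a i j = int (d j) * a j i" using d by (simp add: symmetrizer_def)
    then have "\<bar>int (d i) * a i j\<bar> = \<bar>int (d j) * a j i\<bar>" by simp
    then have "int (d i) * \<bar>a i j\<bar> = int (d j) * \<bar>a j i\<bar>" by (simp add: abs_mult)
    from arg_cong[OF this, of "of_int :: int \<Rightarrow> complex"] show ?thesis by (simp add: mult.assoc)
  qed
  then have "?c i / 2 * of_int \<bar>a i j\<bar> = ?c j / 2 * of_int \<bar>a j i\<bar>"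
    by (simp only: times_divide_eq_left)
  then have key: "?E i * exp_sum (?c i) (a i j) = ?E j * exp_sum (?c j) (a j i)"
    by (simp only: exp_sum_telescope)
  have "borel_log (?q (monic_generator a d hbar j \<mu>) i) = ?E i * borel_log (\<mu> i) -
      (if i = j then 1 else - 1) * (?E i * exp_sum (?c i) (a i j)) * borel_log (\<mu> j)"
    using \<mu> unfolding borel_log_q2D_quotient[OF gen]
    by (simp add: monic_generator_def borel_log_series_reflection carrier_monic_group series_cartan_def algebra_simps)
  also have "\<dots> = borel_log (unit_generator_auto a d hbar j (?q \<mu>) i)"
  proof -
    have unit: "borel_log (unit_generator_auto a d hbar j (?q \<mu>) i) =
        borel_log (?q \<mu> i) - series_cartan (\<lambda>_. ?c j) (a j) j i * borel_log (?q \<mu> j)"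
      using q by (simp add: unit_generator_eq borel_log_series_reflection carrier_unit_group unit_series_iff_monic)
    show ?thesis
      unfolding unit key borel_log_q2D_quotient[OF \<mu>]
      by (cases "i = j") (simp_all add: series_cartan_def algebra_simps)
  qed
  finally show "?q (monic_generator a d hbar j \<mu>) i = unit_generator_auto a d hbar j (?q \<mu>) i"
    using q2D_quotient_unit_group[OF gen, of d hbar]
      auto_closed[OF unit_generator_auto[of a j d hbar, OF diag] q]
    by (intro inj_onD[OF inj_on_borel_log]) (blast intro: unit_group_monic)+
qed

lemma braid_relations_monic_generator:
  assumes a: "simple_cartan_matrix a" and d: "symmetrizer a d" and "hbar \<noteq> 0"
  shows "braid_relations a (AutoGroup monic_group) (monic_generator a d hbar)"
proof (rule braid_relations_inj[where \<phi> = "q2D_quotient d hbar" and g = "unit_generator_auto a d hbar"])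
  have diag: "a j j = 2" for j using a by (simp add: simple_cartan_matrix_def)
  show "\<forall>j. monic_generator a d hbar j \<in> auto monic_group"
    by (simp add: monic_generator_auto diag)
  show "\<forall>j. unit_generator_auto a d hbar j \<in> auto unit_group"
    by (intro allI unit_generator_auto diag)
  show "inj_on (q2D_quotient d hbar) (carrier monic_group)"
    using d assms(3) by (intro inj_on_q2D_quotient) (simp_all add: symmetrizer_def)
  show "braid_relations a (AutoGroup unit_group) (unit_generator_auto a d hbar)"
    using a d by (rule braid_relations_unit_generator)
  show "q2D_quotient d hbar (monic_generator a d hbar j \<mu>) =
      unit_generator_auto a d hbar j (q2D_quotient d hbar \<mu>)" if "\<mu> \<in> carrier monic_group" for j \<mu>
    using d diag that by (rule q2D_quotient_monic_generator)
qed (simp_all add: group_monic_group group_unit_group q2D_quotient_unit_group)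

section \<open>Degrees and the weight lattice\<close>

abbreviation weight_reflection :: "('i \<Rightarrow> 'i \<Rightarrow> int) \<Rightarrow> 'i \<Rightarrow> ('i \<Rightarrow> int) \<Rightarrow> 'i \<Rightarrow> int" where
  "weight_reflection a j \<equiv> restrict (simple_reflection a j) (carrier weight_lattice)"

lemma carrier_weight_lattice: "carrier weight_lattice = UNIV"
  by (auto simp: weight_lattice_def PiE_UNIV_domain)

lemma comm_group_integer_group: "comm_group integer_group"
  by (rule group.group_comm_groupI) auto

lemma group_weight_lattice: "group weight_lattice"
  unfolding weight_lattice_def by (rule product_group) simp

lemma weight_reflection_auto:
  assumes "a j j = 2" shows "weight_reflection a j \<in> auto weight_lattice"
proof -
  have "bij_betw (uminus :: int \<Rightarrow> int) (carrier integer_group) (carrier integer_group)"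
    by (rule bij_betw_byWitness[where f' = "uminus :: int \<Rightarrow> int"]) auto
  moreover have "(uminus :: int \<Rightarrow> int) \<in> hom integer_group integer_group"
    and "(\<lambda>k. - (k * a i j)) \<in> hom integer_group integer_group" for i
    by (auto intro!: homI simp: algebra_simps)
  ultimately have "(\<lambda>x\<in>carrier weight_lattice. \<lambda>i. if i = j then - x j else x i \<otimes>\<^bsub>integer_group\<^esub> - (x j * a i j))
      \<in> auto weight_lattice"
    unfolding weight_lattice_def
    using transvection_auto[OF comm_group_integer_group, of uminus "\<lambda>i k. - (k * a i j)" j] by simp
  also have "(\<lambda>x\<in>carrier weight_lattice. \<lambda>i. if i = j then - x j else x i \<otimes>\<^bsub>integer_group\<^esub> - (x j * a i j))
      = weight_reflection a j"
    using assms by (auto simp: simple_reflection_def fun_eq_iff)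
  finally show ?thesis .
qed

text \<open>The degree is the constant term of \<open>borel_log\<close>, and at \<open>z = 0\<close> the sums of exponentials become the
  absolute values of the entries of the Cartan matrix.\<close>

lemma deg_tuple_monic_generator:
  assumes a: "simple_cartan_matrix a" and \<mu>: "\<mu> \<in> carrier monic_group"
  shows "deg_tuple (monic_generator a d hbar j \<mu>) = weight_reflection a j (deg_tuple \<mu>)"
proof
  fix i
  have aij: "a j j = 2" "i \<noteq> j \<Longrightarrow> a i j \<le> 0" using a by (auto simp: simple_cartan_matrix_def)
  have "monic_generator a d hbar j \<mu> \<in> carrier monic_group"
    using monic_generator_auto[of a j, OF aij(1)] \<mu> by (rule auto_closed)
  then have "of_int (deg_tuple (monic_generator a d hbar j \<mu>) i) =
      fps_nth (borel_log (monic_generator a d hbar j \<mu> i)) 0"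
    by (simp add: deg_tuple_def borel_log_nth_0 carrier_monic_group)
  also have "\<dots> = (of_int (simple_reflection a j (deg_tuple \<mu>) i) :: complex)"
    using \<mu> aij
    by (cases "i = j") (simp_all add: monic_generator_def borel_log_series_reflection carrier_monic_group
        borel_log_nth_0 series_cartan_def exp_sum_nth_0 simple_reflection_def deg_tuple_def)
  finally show "deg_tuple (monic_generator a d hbar j \<mu>) i = weight_reflection a j (deg_tuple \<mu>) i"
    by (simp add: carrier_weight_lattice)
qed

lemma deg_tuple_surj: "deg_tuple ` carrier monic_group = carrier weight_lattice"
proof -
  have "k \<in> deg_tuple ` carrier monic_group" for k :: "'i \<Rightarrow> int"
  proof
    have X: "fls_X_intpow (- n) \<in> monic_series" for n
      using monic_powi[OF monic_X, of "- n"] by simp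
    then show "(\<lambda>i. fls_X_intpow (- k i)) \<in> carrier monic_group" by (simp add: carrier_monic_group)
    show "k = deg_tuple (\<lambda>i. fls_X_intpow (- k i))"
      using deg_series_monic[OF X] by (simp add: deg_tuple_def fun_eq_iff)
  qed
  then show ?thesis by (auto simp: carrier_weight_lattice)
qed

text \<open>The relations are those of the lifts for any nonzero value of \<open>\<hbar>\<close>; the value 1 serves as a witness.\<close>

lemma braid_relations_weight_reflection:
  assumes a: "simple_cartan_matrix a" and d: "symmetrizer a d"
  shows "braid_relations a (AutoGroup weight_lattice) (weight_reflection a)"
proof (rule braid_relations_surj[where \<phi> = deg_tuple and f = "monic_generator a d 1"])
  have diag: "a j j = 2" for j using a by (simp add: simple_cartan_matrix_def)
  show "\<forall>j. monic_generator a d 1 j \<in> auto monic_group"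
    by (simp add: monic_generator_auto diag)
  show "\<forall>j. weight_reflection a j \<in> auto weight_lattice"
    by (intro allI weight_reflection_auto diag)
  show "braid_relations a (AutoGroup monic_group) (monic_generator a d 1)"
    using a d by (rule braid_relations_monic_generator) simp
qed (simp_all only: group_monic_group group_weight_lattice deg_tuple_surj deg_tuple_monic_generator[OF a])

section \<open>The lifted action of the braid group\<close>

theorem proposition4p4:
  fixes a :: "'i::finite \<Rightarrow> 'i \<Rightarrow> int" and d :: "'i \<Rightarrow> nat" and hbar :: complex
  assumes "simple_cartan_matrix a"
    and "minimal_symmetrizer a d"
    and "hbar \<noteq> 0"
  shows "(\<forall>\<sigma>\<in>carrier (braid_group a). \<forall>\<mu>\<in>carrier monic_group.
            \<exists>!\<nu>. \<nu> \<in> carrier monic_group \<and>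
              unit_action a d hbar \<sigma> (q2D_quotient d hbar \<mu>) = q2D_quotient d hbar \<nu>) \<and>
         group_hom (braid_group a) (AutoGroup monic_group)
           (\<lambda>\<sigma>. restrict (monic_action a d hbar \<sigma>) (carrier monic_group)) \<and>
         (\<forall>\<sigma>\<in>carrier (braid_group a). \<forall>\<mu>\<in>carrier monic_group.
            deg_tuple (monic_action a d hbar \<sigma> \<mu>) = weight_action a \<sigma> (deg_tuple \<mu>))"
proof -
  let ?U = "AutoGroup unit_group" and ?M = "AutoGroup monic_group" and ?W = "AutoGroup weight_lattice"
  let ?u = "unit_generator_auto a d hbar" and ?m = "monic_generator a d hbar" and ?w = "weight_reflection a"
  let ?q = "q2D_quotient d hbar"
  have d: "symmetrizer a d" using assms(2) by (simp add: minimal_symmetrizer_def)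
  have diag: "\<And>j. a j j = 2" using assms(1) by (simp add: simple_cartan_matrix_def)
  have u: "\<forall>j. ?u j \<in> auto unit_group" by (intro allI unit_generator_auto diag)
  have m: "\<forall>j. ?m j \<in> auto monic_group" by (intro allI monic_generator_auto diag)
  have w: "\<forall>j. ?w j \<in> auto weight_lattice" by (intro allI weight_reflection_auto diag)
  have groups: "group ?U" "group ?M" "group ?W"
    by (intro group.AutoGroup group_unit_group group_monic_group group_weight_lattice)+
  have u': "\<forall>j. ?u j \<in> carrier ?U" unfolding carrier_AutoGroup by (fact u)
  have m': "\<forall>j. ?m j \<in> carrier ?M" unfolding carrier_AutoGroup by (fact m)
  have w': "\<forall>j. ?w j \<in> carrier ?W" unfolding carrier_AutoGroup by (fact w)
  have unit_action: "unit_action a d hbar (braid_class a v) = eval_word ?U ?u v" for v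
    unfolding unit_action_def
    by (rule braid_hom_class[OF groups(1) u' braid_relations_unit_generator[OF assms(1) d]])
  have weight_action: "weight_action a (braid_class a v) = eval_word ?W ?w v" for v
    unfolding weight_action_def
    by (rule braid_hom_class[OF groups(3) w' braid_relations_weight_reflection[OF assms(1) d]])
  note m_rel = braid_relations_monic_generator[OF assms(1) d assms(3)]
  have inj: "inj_on ?q (carrier monic_group)"
    using d assms(3) by (intro inj_on_q2D_quotient) (simp_all add: symmetrizer_def)
  have closed: "eval_word ?M ?m v \<mu> \<in> carrier monic_group" if "\<mu> \<in> carrier monic_group" for v \<mu>
    using eval_word_auto[OF group_monic_group m] that by (rule auto_closed)
  have lift: "?q (eval_word ?M ?m v \<mu>) = unit_action a d hbar (braid_class a v) (?q \<mu>)"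
    if "\<mu> \<in> carrier monic_group" for v \<mu>
    unfolding unit_action using group_monic_group m group_unit_group u _ _ that
    by (rule eval_word_intertwined)
      (simp_all only: q2D_quotient_unit_group q2D_quotient_monic_generator[OF d diag])
  have unique: "\<nu> = eval_word ?M ?m v \<mu>"
    if "\<mu> \<in> carrier monic_group" "\<nu> \<in> carrier monic_group"
      "unit_action a d hbar (braid_class a v) (?q \<mu>) = ?q \<nu>" for v \<mu> \<nu>
    using that(3)[symmetric, folded lift[OF that(1)]] that(2) closed[OF that(1)]
    by (rule inj_onD[OF inj])
  have ex1: "\<exists>!\<nu>. \<nu> \<in> carrier monic_group \<and> unit_action a d hbar (braid_class a v) (?q \<mu>) = ?q \<nu>"
    if "\<mu> \<in> carrier monic_group" for v \<mu>
    using closed[OF that] lift[OF that, symmetric] unique[OF that] by (intro ex1I conjI) blast+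
  have action: "monic_action a d hbar (braid_class a v) \<mu> = eval_word ?M ?m v \<mu>"
    if "\<mu> \<in> carrier monic_group" for v \<mu>
    unfolding monic_action_def
    using closed[OF that] lift[OF that, symmetric] unique[OF that] by (intro the_equality conjI) blast+
  have restr: "restrict (monic_action a d hbar \<sigma>) (carrier monic_group) = braid_hom ?M ?m \<sigma>"
    if \<sigma>: "\<sigma> \<in> carrier (braid_group a)" for \<sigma>
  proof -
    obtain v where v: "\<sigma> = braid_class a v" using \<sigma> by (auto simp: carrier_braid_group)
    have "restrict (monic_action a d hbar \<sigma>) (carrier monic_group) = eval_word ?M ?m v"
      unfolding v
      by (rule extensionalityI[OF restrict_extensional
            auto_extensional[OF eval_word_auto[OF group_monic_group m]]])
        (simp add: action)
    then show ?thesis unfolding v braid_hom_class[OF groups(2) m' m_rel] .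
  qed
  have hom: "group_hom (braid_group a) ?M (\<lambda>\<sigma>. restrict (monic_action a d hbar \<sigma>) (carrier monic_group))"
  proof -
    interpret h: group_hom "braid_group a" ?M "braid_hom ?M ?m"
      by (rule group_hom_braid_hom[OF groups(2) m' m_rel])
    have "(\<lambda>\<sigma>. restrict (monic_action a d hbar \<sigma>) (carrier monic_group)) \<in> hom (braid_group a) ?M"
    proof (rule homI)
      fix \<sigma> \<tau> assume "\<sigma> \<in> carrier (braid_group a)" "\<tau> \<in> carrier (braid_group a)"
      then show "restrict (monic_action a d hbar (\<sigma> \<otimes>\<^bsub>braid_group a\<^esub> \<tau>)) (carrier monic_group) =
          restrict (monic_action a d hbar \<sigma>) (carrier monic_group) \<otimes>\<^bsub>?M\<^esub>
          restrict (monic_action a d hbar \<tau>) (carrier monic_group)"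
        by (simp only: restr h.G.m_closed h.hom_mult)
    qed (simp only: restr h.hom_closed)
    then show ?thesis
      unfolding group_hom_def group_hom_axioms_def using group_braid_group groups(2) by blast
  qed
  have deg: "deg_tuple (monic_action a d hbar (braid_class a v) \<mu>) =
      weight_action a (braid_class a v) (deg_tuple \<mu>)"
    if "\<mu> \<in> carrier monic_group" for v \<mu>
    unfolding weight_action action[OF that]
    using group_monic_group m group_weight_lattice w _ _ that
    by (rule eval_word_intertwined)
      (simp_all only: deg_tuple_monic_generator[OF assms(1)] carrier_weight_lattice UNIV_I)
  show ?thesis
  proof (intro conjI ballI)
    fix \<sigma> and \<mu> :: "'i \<Rightarrow> complex fls"
    assume "\<sigma> \<in> carrier (braid_group a)" and \<mu>: "\<mu> \<in> carrier monic_group"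
    then obtain v where v: "\<sigma> = braid_class a v" by (auto simp: carrier_braid_group)
    show "\<exists>!\<nu>. \<nu> \<in> carrier monic_group \<and> unit_action a d hbar \<sigma> (?q \<mu>) = ?q \<nu>"
      unfolding v by (rule ex1[OF \<mu>])
    show "deg_tuple (monic_action a d hbar \<sigma> \<mu>) = weight_action a \<sigma> (deg_tuple \<mu>)"
      unfolding v by (rule deg[OF \<mu>])
  qed (rule hom)
qed

end
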